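(* Let $E$ be an arbitrary subset of $\mathbb{R}^n$ and let $f:E\to\mathbb{R}$, $G:E\to\mathbb{R}^n$ be two functions. There exists a convex function $F:\mathbb{R}^n\to\mathbb{R}$ of class $C^1$ such that $F(x)=f(x)$ and $\nabla F(x)=G(x)$ for all $x\in E$ if and only if conditions (i) and (ii) below are satisfied and there exists a linear subspace $X$ of $\mathbb{R}^n$ for which both (iii) and (iv) below are satisfied. (i) $G$ is continuous and $f(x)\geq f(y)+\langle G(y),x-y\rangle$ for all $x,y\in E$. (ii) If $(x_k)_k\subset E$ is a sequence for which $\lim_{k\to\infty}|G(x_k)|=+\infty$, then $$\lim_{k\to\infty}\frac{\langle G(x_k),x_k\rangle-f(x_k)}{|G(x_k)|}=+\infty.$$ (iii) Let $Y:=\mathrm{span}\{G(x)-G(y) : x,y\in E\}$. Then $X\supseteq Y$ and, either $Y=X$, or else, denoting $k=\dim Y$, $d=\dim X$ and letting $P_X:\mathbb{R}^n\to\mathbb{R}^n$ be the orthogonal projection onto $X$, there exist points $p_1,\ldots,p_{d-k}\in\mathbb{R}^n\setminus\overline{E}$, numbers $\beta_1,\ldots,\beta_{d-k}\in\mathbb{R}$, and vectors $w_1,\ldots,w_{d-k}\in\mathbb{R}^n$ such that: (a) $X=\mathrm{span}\left(\{u-v : u,v\in G(E)\cup\{w_1,\ldots,w_{d-k}\}\}\right)$; (b) $\beta_j>\max_{1\leq i\neq j\leq d-k}\{\beta_i+\langle w_i,p_j-p_i\rangle\}$ for all $1\leq j\leq d-k$; (c) $\beta_j>\sup_{z\in E,\,|G(z)|\leq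 N}\{f(z)+\langle G(z),p_j-z\rangle\}$ for all $1\leq j\leq d-k$ and all $N\in\mathbb{N}$; (d) $\inf_{x\in E,\,|P_X(x)|\leq N}\left\{f(x)-\max_{1\leq j\leq d-k}\{\beta_j+\langle w_j,x-p_j\rangle\}\right\}>0$ for all $N\in\mathbb{N}$. (iv) If $(x_k)_k,(z_k)_k$ are sequences in $E$ such that $(P_X(x_k))_k$ and $(G(z_k))_k$ are bounded and $$\lim_{k\to\infty}\left(f(x_k)-f(z_k)-\langle G(z_k),x_k-z_k\rangle\right)=0,$$ then $\lim_{k\to\infty}|G(x_k)-G(z_k)|=0$.
   Context: $\langle\cdot,\cdot\rangle$ and $|\cdot|$ denote the Euclidean inner product and norm on $\mathbb{R}^n$, and $\overline{E}$ is the closure of $E$. A maximum or supremum over an empty index set is $-\infty$, and an infimum over an empty index set is $+\infty$ (so conditions indexed by empty sets hold vacuously). *)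

theory Defs
  imports "HOL-Analysis.Analysis"
begin

definition orth_proj :: "'a::real_inner set \<Rightarrow> 'a \<Rightarrow> 'a" where
  "orth_proj X x = (THE y. y \<in> X \<and> (\<forall>u\<in>X. (x - y) \<bullet> u = 0))"

lemma orth_proj_unique:
  fixes X :: "'a::real_inner set"
  assumes "subspace X" and "y \<in> X" and "\<forall>u\<in>X. (x - y) \<bullet> u = 0"
  shows "orth_proj X x = y"
  unfolding orth_proj_def
proof (rule the_equality)
  fix z assume z: "z \<in> X \<and> (\<forall>u\<in>X. (x - z) \<bullet> u = 0)"
  then have "z - y \<in> X" using assms by (simp add: subspace_diff)
  then have "(x - y) \<bullet> (z - y) = 0" "(x - z) \<bullet> (z - y) = 0" using assms z by auto
  then have "(z - y) \<bullet> (z - y) = 0" by (simp add: inner_diff_left)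
  then show "z = y" by simp
qed (use assms in auto)

lemma orth_proj:
  fixes X :: "'a::euclidean_space set"
  assumes "subspace X"
  shows "orth_proj X x \<in> X" and "\<forall>u\<in>X. (x - orth_proj X x) \<bullet> u = 0"
proof -
  obtain y z where yz: "y \<in> span X" "\<And>w. w \<in> span X \<Longrightarrow> orthogonal z w" "x = y + z"
    using orthogonal_subspace_decomp_exists by blast
  have "span X = X" using assms by simp
  with yz have "y \<in> X" "\<forall>u\<in>X. (x - y) \<bullet> u = 0" by (auto simp: orthogonal_def)
  with orth_proj_unique[OF assms this]
  show "orth_proj X x \<in> X" and "\<forall>u\<in>X. (x - orth_proj X x) \<bullet> u = 0" by auto
qed

definition class_C1 :: "('a::real_inner \<Rightarrow> real) \<Rightarrow> bool" where
  "class_C1 F \<longleftrightarrow> (\<exists>g. (\<forall>x. GDERIV F x :> g x) \<and> continuous_on UNIV g)"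

end

(* Necessity. Take X spanned by all differences of gradients of F. Along the complement of X, F is
   affine with a constant slope, so the Bregman gap F x - F z - grad F z . (x - z) depends only on
   P_X x and z; when P_X x stays bounded and the gap tends to 0, the approximate subgradients
   grad F z converge to the gradient at a limit of the P_X x. Points p_j whose gradients complete a
   basis of Y to one of X have gradients away from G(E), so all gaps involving them are bounded
   below.

   Sufficiency. Adding the p_j to E gives X = Y. After subtracting a linear function, the supremum m
   of the tangent planes is X-invariant and coercive on X, and (iv) says that it is differentiable
   on C, the closure of P_X(E). Replace m by m + |x - P_X x|^2, which is coercive on the whole space.
   With delta the distance to C, the function m + delta^2 is regularised from above to a continuous
   H >= m which equals m on C and has an affine upper first-order approximation at each point.
   These one-sided expansions pass to the convex envelope of H, where convexity turns them into
   differentiability; composing with P_X gives the extension. *)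

theory Submission
  imports Defs
begin

section \<open>Superdifferentials and convexity\<close>

text \<open>Only upper expansions are carried through the construction
  (\<open>superdiff F x g\<close> says that g is a Frechet supergradient), because they survive two
  operations that may destroy differentiability: a minimum, where the competitor optimal at x
  touches from above, and a convex hull, where a single atom is moved. A convex function with such
  an expansion at every point is automatically of class C1, so no gradient of the extension has to
  be computed.

  The obstacle is to restore convexity without changing the values on C. Since m is itself convex,
  it stays below the convex envelope of H, which stays below H; on C the two bounds agree. Off C the
  term delta^2 leaves room strictly above m for smooth barriers whose radii shrink to 0 at C; being
  of second order at C, it does not disturb the expansion of m there.

  In the sufficiency direction, (ii) makes m finite, while (b), (c), (d) are the gaps that keep (iv)
  true once the p_j join E.\<close>

definition superdiff :: "('a::euclidean_space \<Rightarrow> real) \<Rightarrow> 'a \<Rightarrow> 'a \<Rightarrow> bool" where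
  "superdiff F x g \<longleftrightarrow> (\<forall>e>0. \<exists>d>0. \<forall>h. norm h < d \<longrightarrow> F (x + h) \<le> F x + g \<bullet> h + e * norm h)"

lemma superdiffD:
  assumes "superdiff F x g" "e > 0"
  obtains d where "d > 0" "\<And>h. norm h < d \<Longrightarrow> F (x + h) \<le> F x + g \<bullet> h + e * norm h"
  using assms unfolding superdiff_def by blast

text \<open>This is how a minimum over a family inherits an expansion: U is the competitor that is
  optimal at x, frozen while the point varies.\<close>

lemma superdiff_upper_touch:
  assumes u: "superdiff U x g" and le: "\<forall>\<^sub>F y in nhds x. F y \<le> U y" and eq: "U x \<le> F x"
  shows "superdiff F x g"
  unfolding superdiff_def
proof (intro allI impI)
  fix e :: real assume "e > 0"
  with u obtain d where d: "d > 0" "\<And>h. norm h < d \<Longrightarrow> U (x + h) \<le> U x + g \<bullet> h + e * norm h"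
    using superdiffD by metis
  obtain d' where d': "d' > 0" "\<And>y. dist y x < d' \<Longrightarrow> F y \<le> U y"
    using le unfolding eventually_nhds_metric by blast
  show "\<exists>d>0. \<forall>h. norm h < d \<longrightarrow> F (x + h) \<le> F x + g \<bullet> h + e * norm h"
  proof (intro exI[of _ "min d d'"] conjI allI impI)
    fix h :: 'a assume h: "norm h < min d d'"
    have "F (x + h) \<le> U (x + h)" by (rule d'(2)) (use h in \<open>simp add: dist_norm\<close>)
    also have "\<dots> \<le> U x + g \<bullet> h + e * norm h" by (rule d(2)) (use h in simp)
    finally show "F (x + h) \<le> F x + g \<bullet> h + e * norm h" using eq by linarith
  qed (use d d' in auto)
qed

lemma superdiff_GDERIV:
  assumes "GDERIV U x :> g"
  shows "superdiff U x g"
  unfolding superdiff_def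
proof (intro allI impI)
  fix e :: real assume "e > 0"
  then obtain d where d: "d > 0" "\<And>y. norm (y - x) < d \<Longrightarrow> norm (U y - U x - (y - x) \<bullet> g) \<le> e * norm (y - x)"
    using assms unfolding gderiv_def has_derivative_at_alt by blast
  show "\<exists>d>0. \<forall>h. norm h < d \<longrightarrow> U (x + h) \<le> U x + g \<bullet> h + e * norm h"
  proof (intro exI[of _ d] conjI allI impI d(1))
    fix h :: 'a assume "norm h < d"
    then show "U (x + h) \<le> U x + g \<bullet> h + e * norm h"
      using d(2)[of "x + h"] by (simp add: inner_commute abs_le_iff)
  qed
qed

lemma superdiff_add:
  assumes F: "superdiff F x g" and K: "superdiff K x k"
  shows "superdiff (\<lambda>y. F y + K y) x (g + k)"
  unfolding superdiff_def
proof (intro allI impI)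
  fix e :: real assume "e > 0"
  then have e: "e / 2 > 0" by simp
  obtain d1 where d1: "d1 > 0" "\<And>h. norm h < d1 \<Longrightarrow> F (x + h) \<le> F x + g \<bullet> h + e / 2 * norm h"
    by (rule superdiffD[OF F e]) blast
  obtain d2 where d2: "d2 > 0" "\<And>h. norm h < d2 \<Longrightarrow> K (x + h) \<le> K x + k \<bullet> h + e / 2 * norm h"
    by (rule superdiffD[OF K e]) blast
  show "\<exists>d>0. \<forall>h. norm h < d \<longrightarrow> F (x + h) + K (x + h) \<le> F x + K x + (g + k) \<bullet> h + e * norm h"
  proof (intro exI[of _ "min d1 d2"] conjI allI impI)
    fix h :: 'a assume "norm h < min d1 d2"
    then show "F (x + h) + K (x + h) \<le> F x + K x + (g + k) \<bullet> h + e * norm h"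
      using d1(2)[of h] d2(2)[of h] by (simp add: inner_add_left)
  qed (use d1 d2 in auto)
qed

lemma superdiff_usc:
  assumes "superdiff F x g" "e > 0"
  shows "\<forall>\<^sub>F y in nhds x. F y < F x + e"
proof -
  obtain d where d: "d > 0" "\<And>h. norm h < d \<Longrightarrow> F (x + h) \<le> F x + g \<bullet> h + 1 * norm h"
    by (rule superdiffD[OF assms(1) zero_less_one]) blast
  have "((\<lambda>y. g \<bullet> (y - x) + norm (y - x)) \<longlongrightarrow> g \<bullet> (x - x) + norm (x - x)) (nhds x)"
    by (intro tendsto_intros filterlim_ident)
  then have "\<forall>\<^sub>F y in nhds x. g \<bullet> (y - x) + norm (y - x) < e"
    using \<open>e > 0\<close> by (auto dest!: order_tendstoD(2))
  moreover have "\<forall>\<^sub>F y in nhds x. dist y x < d"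
    using d(1) by (auto simp: eventually_nhds_metric)
  ultimately show ?thesis
  proof eventually_elim
    case (elim y)
    then show ?case using d(2)[of "y - x"] by (simp add: dist_norm)
  qed
qed

text \<open>Convexity gives \<open>F (x + h) + F (x - h) \<ge> 2 * F x\<close>, so the upper
  expansion at -h is a lower expansion at h.\<close>

lemma convex_superdiff_GDERIV:
  assumes cv: "convex_on UNIV F" and sd: "superdiff F x g"
  shows "GDERIV F x :> g"
  unfolding gderiv_def has_derivative_at_alt
proof (intro conjI allI impI)
  show "bounded_linear (\<lambda>h. h \<bullet> g)" by (rule bounded_linear_inner_left)
  fix e :: real assume "e > 0"
  then obtain d where d: "d > 0" "\<And>h. norm h < d \<Longrightarrow> F (x + h) \<le> F x + g \<bullet> h + e * norm h"
    using sd superdiffD by metis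
  show "\<exists>d>0. \<forall>y. norm (y - x) < d \<longrightarrow> norm (F y - F x - (y - x) \<bullet> g) \<le> e * norm (y - x)"
  proof (intro exI[of _ d] conjI allI impI d(1))
    fix y assume y: "norm (y - x) < d"
    define h where "h = y - x"
    have h: "norm h < d" "norm (-h) < d" using y by (auto simp only: h_def norm_minus_cancel)
    have "F ((1/2) *\<^sub>R (x + h) + (1/2) *\<^sub>R (x + -h)) \<le> 1/2 * F (x + h) + 1/2 * F (x + -h)"
      using convex_onD[OF cv, of "1/2" "x + h" "x + -h"] by simp
    moreover have "(1/2) *\<^sub>R (x + h) + (1/2) *\<^sub>R (x + -h) = x"
      by (simp add: algebra_simps flip: scaleR_add_left)
    ultimately have "2 * F x \<le> F (x + h) + F (x + -h)" by simp
    then show "norm (F y - F x - (y - x) \<bullet> g) \<le> e * norm (y - x)"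
      using d(2)[OF h(1)] d(2)[OF h(2)] by (simp add: h_def abs_le_iff inner_commute inner_diff_right norm_minus_commute[of x y])
  qed
qed

lemma convex_GDERIV_ge:
  assumes cv: "convex_on UNIV F" and gd: "GDERIV F x :> g"
  shows "F y \<ge> F x + g \<bullet> (y - x)"
proof (rule field_le_epsilon)
  fix e :: real assume e: "e > 0"
  define h where "h = y - x"
  \<comment> \<open>The added 1 keeps the denominators here and in t positive when h = 0.\<close>
  define c where "c = e / (norm h + 1)"
  have c: "c > 0" using e by (simp add: c_def add_nonneg_pos)
  then obtain d where d: "d > 0" "\<And>y. norm (y - x) < d \<Longrightarrow> norm (F y - F x - (y - x) \<bullet> g) \<le> c * norm (y - x)"
    using gd unfolding gderiv_def has_derivative_at_alt by blast
  define t where "t = min 1 (d / (2 * (norm h + 1)))"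
  have p: "norm h + 1 > 0" by (simp add: add_nonneg_pos)
  have t: "t > 0" "t \<le> 1" using d(1) p by (auto simp: t_def)
  have "t * norm h \<le> d / (2 * (norm h + 1)) * norm h"
    by (intro mult_right_mono) (auto simp: t_def)
  also have "\<dots> < d" using d(1) p by (simp add: field_simps) (smt (verit) mult_nonneg_nonneg norm_ge_zero)
  finally have "norm (x + t *\<^sub>R h - x) < d" using t by simp
  from d(2)[OF this] have "F (x + t *\<^sub>R h) \<ge> F x + t * (h \<bullet> g) - c * (t * norm h)"
    using t by (simp add: abs_le_iff)
  moreover have "F (x + t *\<^sub>R h) \<le> (1 - t) * F x + t * F y"
  proof -
    have "x + t *\<^sub>R h = (1 - t) *\<^sub>R x + t *\<^sub>R y" by (simp add: h_def algebra_simps)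
    then show ?thesis using convex_onD[OF cv, of t x y] t by simp
  qed
  ultimately have "t * (F x + h \<bullet> g - c * norm h) \<le> t * F y" by (simp add: algebra_simps)
  then have "F x + h \<bullet> g - c * norm h \<le> F y" using t by simp
  moreover have "c * norm h \<le> e" using p e by (simp add: c_def field_simps)
  ultimately show "F x + g \<bullet> (y - x) \<le> F y + e" by (simp add: h_def inner_commute)
qed

text \<open>Test the approximate subgradient q at \<open>x' + t *\<^sub>R v\<close>, where v is the
  direction of \<open>q - g\<close>. This point lies within 2t of x, so the upper expansion at x
  limits the gain \<open>t * norm (q - g)\<close>. The same estimate yields uniqueness of
  subgradients, continuity of gradients and the limits needed for (iv).\<close>

lemma approximate_subgradient_close:
  assumes sd: "\<And>h. norm h \<le> 2 * t \<Longrightarrow> F (x + h) \<le> F x + g \<bullet> h + e * norm h"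
    and t: "t > 0" "e \<ge> 0" "norm (x' - x) \<le> t"
    and x': "F x' \<ge> F x + g \<bullet> (x' - x)"
    and q: "\<And>y. F y \<ge> F x' - \<eta> + q \<bullet> (y - x')" and "\<eta> \<ge> 0"
  shows "t * norm (q - g) \<le> \<eta> + 2 * e * t"
proof -
  define v where "v = sgn (q - g)"
  have v: "norm v \<le> 1" "(q - g) \<bullet> v = norm (q - g)"
    by (cases "q = g"; simp add: v_def norm_sgn sgn_div_norm power2_norm_eq_inner[symmetric] power2_eq_square)+
  define h where "h = x' - x + t *\<^sub>R v"
  have "norm h \<le> norm (x' - x) + norm (t *\<^sub>R v)" unfolding h_def by (rule norm_triangle_ineq)
  also have "\<dots> \<le> t + t" using t v by (intro add_mono) (auto simp: mult_left_le)
  finally have h: "norm h \<le> 2 * t" by simp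
  have "F x' - \<eta> + q \<bullet> (t *\<^sub>R v) \<le> F (x + h)"
    using q[of "x + h"] by (simp add: h_def)
  also have "\<dots> \<le> F x + g \<bullet> h + e * norm h" using sd h by simp
  also have "\<dots> \<le> F x + g \<bullet> h + e * (2 * t)" using h t by (intro add_left_mono mult_left_mono)
  finally have "t * ((q - g) \<bullet> v) \<le> \<eta> + 2 * e * t"
    using x' by (simp add: h_def inner_diff inner_add algebra_simps)
  then show ?thesis using v by simp
qed

lemma superdiff_subgradient_unique:
  assumes sd: "superdiff F x g" and q: "\<And>y. F y \<ge> F x + q \<bullet> (y - x)"
  shows "q = g"
proof -
  have "norm (q - g) \<le> e" if "e > 0" for e
  proof -
    obtain d where d: "d > 0" "\<And>h. norm h < d \<Longrightarrow> F (x + h) \<le> F x + g \<bullet> h + e / 2 * norm h"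
      using superdiffD[OF sd, of "e / 2"] \<open>e > 0\<close> by auto
    \<comment> \<open>With t = d / 4 the closed ball of radius 2t lies inside the open ball of
      radius d.\<close>
    have "d / 4 * norm (q - g) \<le> 0 + 2 * (e / 2) * (d / 4)"
      by (rule approximate_subgradient_close[of _ F x _ _ x]) (use d \<open>e > 0\<close> q in auto)
    then show ?thesis using d by simp
  qed
  then have "norm (q - g) \<le> 0" by (rule field_le_epsilon[of _ 0, simplified])
  then show ?thesis by simp
qed

text \<open>The slopes Q k are tied only to the convergent base points X k. They may be gradients at
  points that escape to infinity, as happens with the z k in (iv).\<close>

lemma approximate_subgradients_tendsto:
  fixes F :: "'a::euclidean_space \<Rightarrow> real"
  assumes cv: "convex_on UNIV F" and gd: "GDERIV F x :> g"
    and lim: "X \<longlonglongrightarrow> x" "\<eta> \<longlonglongrightarrow> 0"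
    and q: "\<And>k y. F y \<ge> F (X k) - \<eta> k + Q k \<bullet> (y - X k)" and \<eta>0: "\<And>k. \<eta> k \<ge> 0"
  shows "Q \<longlonglongrightarrow> g"
proof (rule LIMSEQ_I)
  fix e :: real assume e: "e > 0"
  obtain d where d: "d > 0" "\<And>h. norm h < d \<Longrightarrow> F (x + h) \<le> F x + g \<bullet> h + e / 8 * norm h"
    using superdiffD[OF superdiff_GDERIV[OF gd], of "e / 8"] e by auto
  define t where "t = d / 4"
  have t: "t > 0" using d by (simp add: t_def)
  obtain K1 where K1: "\<And>k. k \<ge> K1 \<Longrightarrow> norm (X k - x) < t" using LIMSEQ_D[OF lim(1) t] by blast
  have "e / 2 * t > 0" using e t by simp
  then obtain K2 where K2: "\<And>k. k \<ge> K2 \<Longrightarrow> norm (\<eta> k - 0) < e / 2 * t" using LIMSEQ_D[OF lim(2)] by blast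
  have "norm (Q k - g) < e" if k: "k \<ge> max K1 K2" for k
  proof -
    have "t * norm (Q k - g) \<le> \<eta> k + 2 * (e / 8) * t"
      by (rule approximate_subgradient_close[of _ F x _ _ "X k"])
        (use d t_def t e K1[of k] k q \<eta>0 convex_GDERIV_ge[OF cv gd] in auto)
    also have "\<dots> < e * t" using K2[of k] k e t by (simp add: abs_less_iff)
    finally show ?thesis using t by (simp add: mult.commute)
  qed
  then show "\<exists>no. \<forall>n\<ge>no. norm (Q n - g) < e" by blast
qed

lemma convex_superdiff_class_C1:
  fixes F :: "'a::euclidean_space \<Rightarrow> real"
  assumes cv: "convex_on UNIV F" and sd: "\<And>x. \<exists>g. superdiff F x g"
  shows "class_C1 F"
proof -
  obtain g where "\<And>x. superdiff F x (g x)" using sd by metis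
  then have g: "\<And>x. GDERIV F x :> g x" using convex_superdiff_GDERIV[OF cv] by blast
  have "continuous_on UNIV g"
    unfolding continuous_on_sequentially comp_def
  proof (intro ballI allI impI, elim conjE)
    fix a :: 'a and X :: "nat \<Rightarrow> 'a" assume "X \<longlonglongrightarrow> a"
    then show "(\<lambda>n. g (X n)) \<longlonglongrightarrow> g a"
      by (rule approximate_subgradients_tendsto[OF cv g, where \<eta> = "\<lambda>_. 0"])
        (use convex_GDERIV_ge[OF cv g] in auto)
  qed
  with g show ?thesis unfolding class_C1_def by blast
qed

section \<open>The convex envelope\<close>

text \<open>The hull of the epigraph need not be closed, so its lower boundary is an infimum that
  may fail to be attained. The fibre over x is nonempty because it contains \<open>H x\<close>; a
  convex minorant M of H bounds it from below, which is why M accompanies the estimates that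
  follow.\<close>

definition convex_envelope :: "('a::euclidean_space \<Rightarrow> real) \<Rightarrow> 'a \<Rightarrow> real" where
  "convex_envelope H x = Inf {t. (x, t) \<in> convex hull (epigraph UNIV H)}"

lemma hull_epigraph_ge:
  assumes "convex_on UNIV M" "\<And>x. M x \<le> H x" "(x, t) \<in> convex hull (epigraph UNIV H)"
  shows "M x \<le> t"
proof -
  have "epigraph UNIV H \<subseteq> epigraph UNIV M"
    using order_trans[OF assms(2)] by (simp add: epigraph_def subset_iff)
  then have "convex hull (epigraph UNIV H) \<subseteq> epigraph UNIV M"
    by (rule hull_minimal) (use assms(1) in \<open>simp add: convex_epigraph\<close>)
  with assms(3) show ?thesis by (auto simp: epigraph_def)
qed

lemma graph_in_hull_epigraph: "H x \<le> t \<Longrightarrow> (x, t) \<in> convex hull (epigraph UNIV H)"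
  by (intro hull_inc) (auto simp: epigraph_def)

lemma convex_envelope_ge:
  assumes "convex_on UNIV M" "\<And>x. M x \<le> H x"
  shows "M x \<le> convex_envelope H x"
  unfolding convex_envelope_def
  by (rule cInf_greatest) (use hull_epigraph_ge[OF assms] graph_in_hull_epigraph in blast)+

lemma convex_envelope_le:
  assumes "convex_on UNIV M" "\<And>x. M x \<le> H x" "(x, t) \<in> convex hull (epigraph UNIV H)"
  shows "convex_envelope H x \<le> t"
  unfolding convex_envelope_def
  by (rule cInf_lower) (use hull_epigraph_ge[OF assms(1,2)] assms(3) in \<open>auto intro!: bdd_belowI[of _ "M x"]\<close>)

lemma convex_envelope_approx:
  assumes "e > 0"
  obtains t where "(x, t) \<in> convex hull (epigraph UNIV H)" "t < convex_envelope H x + e"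
proof -
  have "{t. (x, t) \<in> convex hull (epigraph UNIV H)} \<noteq> {}" using graph_in_hull_epigraph by blast
  from cInf_lessD[OF this, of "convex_envelope H x + e"] assms that show ?thesis
    by (auto simp: convex_envelope_def)
qed

lemma convex_on_convex_envelope:
  assumes M: "convex_on UNIV M" "\<And>x. M x \<le> H x"
  shows "convex_on UNIV (convex_envelope H)"
proof (rule convex_onI)
  fix t :: real and x y assume t: "0 < t" "t < 1"
  show "convex_envelope H ((1 - t) *\<^sub>R x + t *\<^sub>R y) \<le> (1 - t) * convex_envelope H x + t * convex_envelope H y"
  proof (rule field_le_epsilon)
    fix e :: real assume e: "e > 0"
    obtain r where r: "(x, r) \<in> convex hull (epigraph UNIV H)" "r < convex_envelope H x + e"
      by (rule convex_envelope_approx[OF e])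
    obtain s where s: "(y, s) \<in> convex hull (epigraph UNIV H)" "s < convex_envelope H y + e"
      by (rule convex_envelope_approx[OF e])
    have "(1 - t) *\<^sub>R (x, r) + t *\<^sub>R (y, s) \<in> convex hull (epigraph UNIV H)"
      by (rule convexD[OF convex_convex_hull r(1) s(1)]) (use t in auto)
    then have "convex_envelope H ((1 - t) *\<^sub>R x + t *\<^sub>R y) \<le> (1 - t) * r + t * s"
      by (intro convex_envelope_le[OF M]) simp
    also have "\<dots> \<le> (1 - t) * (convex_envelope H x + e) + t * (convex_envelope H y + e)"
      using r s t by (intro add_mono mult_left_mono) auto
    finally show "convex_envelope H ((1 - t) *\<^sub>R x + t *\<^sub>R y)
        \<le> (1 - t) * convex_envelope H x + t * convex_envelope H y + e"
      by (simp add: algebra_simps)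
  qed
qed auto

text \<open>By Caratheodory at most \<open>DIM('a) + 1\<close> atoms suffice, so one of them carries
  at least the average weight. Replacing that atom alone by v' keeps a convex combination and shifts
  the point by \<open>l *\<^sub>R (v' - v)\<close>.\<close>

lemma convex_hull_exchange:
  fixes S :: "'a::euclidean_space set"
  assumes "z \<in> convex hull S"
  obtains l v where "1 / real (DIM('a) + 1) \<le> l" "l \<le> 1" "v \<in> S"
    "\<And>v'. v' \<in> S \<Longrightarrow> z + l *\<^sub>R (v' - v) \<in> convex hull S"
proof -
  have "\<exists>T u. finite T \<and> T \<subseteq> S \<and> card T \<le> DIM('a) + 1 \<and> (\<forall>x\<in>T. 0 \<le> u x) \<and> sum u T = 1
      \<and> (\<Sum>v\<in>T. u v *\<^sub>R v) = z"
    using assms by (simp only: convex_hull_caratheodory[of S] mem_Collect_eq)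
  then obtain T u where T: "finite T" "T \<subseteq> S" "card T \<le> DIM('a) + 1" and u: "\<And>v. v \<in> T \<Longrightarrow> 0 \<le> u v" "sum u T = 1"
    and z: "(\<Sum>v\<in>T. u v *\<^sub>R v) = z"
    by auto
  have "T \<noteq> {}" using u(2) by auto
  obtain v where v: "v \<in> T" "u v \<ge> 1 / real (DIM('a) + 1)"
  proof (rule ccontr)
    assume "\<not> thesis"
    then have lt: "\<And>v. v \<in> T \<Longrightarrow> u v < 1 / real (DIM('a) + 1)" using that by force
    have "sum u T < (\<Sum>v\<in>T. 1 / real (DIM('a) + 1))"
      by (rule sum_strict_mono) (use T \<open>T \<noteq> {}\<close> lt in auto)
    also have "\<dots> = card T / real (DIM('a) + 1)" by simp
    also have "\<dots> \<le> 1" using T(3) by (simp add: divide_le_eq)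
    finally show False using u(2) by simp
  qed
  show thesis
  proof (rule that)
    show "u v \<le> 1" using u v T member_le_sum[of v T u] by auto
    fix v' assume v': "v' \<in> S"
    have "(\<Sum>w\<in>T. u w *\<^sub>R (if w = v then v' else w)) \<in> convex hull S"
      by (rule convex_sum) (use T u v' hull_inc[of _ S] in \<open>auto simp: convex_convex_hull\<close>)
    also have "(\<Sum>w\<in>T. u w *\<^sub>R (if w = v then v' else w)) = (\<Sum>w\<in>T. u w *\<^sub>R w + (if w = v then u v *\<^sub>R (v' - v) else 0))"
      by (rule sum.cong) (auto simp: algebra_simps)
    also have "\<dots> = z + u v *\<^sub>R (v' - v)"
      using T v z by (simp add: sum.distrib)
    finally show "z + u v *\<^sub>R (v' - v) \<in> convex hull S" .
  qed (use v T in auto)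
qed

lemma superdiff_convex_envelope:
  fixes H :: "'a::euclidean_space \<Rightarrow> real"
  assumes H: "continuous_on UNIV H" and sd: "\<And>x. \<exists>g. superdiff H x g"
    and a: "a > 0" and low: "\<And>x. a * norm x - b \<le> H x"
  shows "\<exists>g. superdiff (convex_envelope H) x g"
proof -
  text \<open>In a nearly optimal Caratheodory combination some weight is at least \<open>1 / N\<close>. Its atom
    stays bounded by coercivity, so it survives in the limit, and moving only this atom bounds the
    envelope near \<^term>\<open>x\<close>. The other atoms may escape to infinity.\<close>
  define M where "M = (\<lambda>_::'a. - b)"
  have M: "convex_on UNIV M" "\<And>x. M x \<le> H x"
  proof -
    show "convex_on UNIV M" by (simp add: M_def convex_on_const)
    show "M x \<le> H x" for x using low[of x] a by (smt (verit) M_def mult_nonneg_nonneg norm_ge_zero)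
  qed
  \<comment> \<open>The hull is taken in the epigraph space, whose dimension is one higher than that
    of \<open>'a\<close>.\<close>
  define N where "N = real (DIM('a \<times> real) + 1)"
  have N: "N > 0" by (simp add: N_def)
  define K where "K = convex hull (epigraph UNIV H)"
  define Q where "Q = (\<lambda>k t l y. t < convex_envelope H x + 1 / real (Suc k) \<and> 1 / N \<le> l \<and> l \<le> 1
     \<and> l * H y \<le> t + b + l * H 0
     \<and> (\<forall>h. convex_envelope H (x + h) \<le> t + l * (H (y + h /\<^sub>R l) - H y)))"
  have "\<exists>t l y. Q k t l y" for k
  proof -
    obtain t where t: "(x, t) \<in> K" "t < convex_envelope H x + 1 / real (Suc k)"
      unfolding K_def using convex_envelope_approx[of "1 / real (Suc k)" x H] by auto
    obtain l v where l: "1 / N \<le> l" "l \<le> 1" and v: "v \<in> epigraph UNIV H"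
      and ex: "\<And>v'. v' \<in> epigraph UNIV H \<Longrightarrow> (x, t) + l *\<^sub>R (v' - v) \<in> K"
      unfolding K_def N_def by (rule convex_hull_exchange[OF t(1)[unfolded K_def]]) blast
    have l0: "l > 0" using l N by (smt (verit) divide_pos_pos)
    obtain y s where vy: "v = (y, s)" "H y \<le> s" using v by (cases v) (auto simp: epigraph_def)
    have ex': "(x + l *\<^sub>R (y' - y), t + l * (H y' - s)) \<in> K" for y'
      using ex[of "(y', H y')"] by (simp add: vy epigraph_def)
    \<comment> \<open>Moving the heavy atom to (0, H 0) gives another point of the hull, whose
      height is at least -b. This bounds \<open>l * H y\<close> without any information on the other
      atoms.\<close>
    have "- b \<le> t + l * (H 0 - s)"
      using hull_epigraph_ge[OF M ex'[of 0, unfolded K_def]] by (simp add: M_def)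
    moreover have "l * H y \<le> l * s" using l0 vy by simp
    ultimately have "l * H y \<le> t + b + l * H 0" by (simp add: algebra_simps)
    moreover have "convex_envelope H (x + h) \<le> t + l * (H (y + h /\<^sub>R l) - H y)" for h
    proof -
      have "convex_envelope H (x + h) \<le> t + l * (H (y + h /\<^sub>R l) - s)"
        using convex_envelope_le[OF M ex'[of "y + h /\<^sub>R l", unfolded K_def]] l0 by simp
      also have "\<dots> \<le> t + l * (H (y + h /\<^sub>R l) - H y)" using l0 vy by simp
      finally show ?thesis .
    qed
    ultimately show ?thesis unfolding Q_def using t l by blast
  qed
  then obtain t l y where Q: "\<And>k. Q k (t k) (l k) (y k)" by metis
  have t: "t k < convex_envelope H x + 1 / real (Suc k)"
    and l: "1 / N \<le> l k" "l k \<le> 1"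
    and ly: "l k * H (y k) \<le> t k + b + l k * H 0"
    and up: "convex_envelope H (x + h) \<le> t k + l k * (H (y k + h /\<^sub>R l k) - H (y k))" for k h
    using Q[of k] by (auto simp: Q_def)
  have l0: "l k > 0" for k using l(1)[of k] N by (smt (verit) divide_pos_pos)
  define R where "R = (N * (\<bar>convex_envelope H x\<bar> + 1 + \<bar>b\<bar>) + \<bar>H 0\<bar> + \<bar>b\<bar>) / a"
  have yR: "norm (y k) \<le> R" for k
  proof -
    have "1 / real (Suc k) \<le> 1" by simp
    then have "t k + b \<le> \<bar>convex_envelope H x\<bar> + 1 + \<bar>b\<bar>" using t[of k] by linarith
    then have *: "l k * (H (y k) - H 0) \<le> \<bar>convex_envelope H x\<bar> + 1 + \<bar>b\<bar>"
      using ly[of k] by (simp add: algebra_simps)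
    \<comment> \<open>The bound \<open>1 / N \<le> l k\<close> can be divided out only when the
      difference is positive; otherwise the claim is trivial.\<close>
    have "H (y k) - H 0 \<le> N * (\<bar>convex_envelope H x\<bar> + 1 + \<bar>b\<bar>)"
    proof (cases "H (y k) - H 0 \<le> 0")
      case True
      then show ?thesis using N by (smt (verit) mult_nonneg_nonneg abs_ge_zero)
    next
      case False
      then have "1 / N * (H (y k) - H 0) \<le> l k * (H (y k) - H 0)" using l by (intro mult_right_mono) auto
      with * have "1 / N * (H (y k) - H 0) \<le> \<bar>convex_envelope H x\<bar> + 1 + \<bar>b\<bar>" by linarith
      then show ?thesis using mult_left_mono[of "1 / N * (H (y k) - H 0)" _ N] N by simp
    qed
    then have "a * norm (y k) \<le> N * (\<bar>convex_envelope H x\<bar> + 1 + \<bar>b\<bar>) + \<bar>H 0\<bar> + \<bar>b\<bar>"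
      using low[of "y k"] by linarith
    then show ?thesis using a by (simp add: R_def field_simps)
  qed
  have "compact ({1 / N..1} \<times> cball (0::'a) R)" by (intro compact_Times) auto
  then have "seq_compact ({1 / N..1} \<times> cball (0::'a) R)" by (simp add: compact_eq_seq_compact_metric)
  moreover have "\<forall>k. (l k, y k) \<in> {1 / N..1} \<times> cball 0 R" using l yR by auto
  ultimately obtain L and r :: "nat \<Rightarrow> nat" where
    L: "L \<in> {1 / N..1} \<times> cball 0 R" "strict_mono r" "((\<lambda>k. (l k, y k)) \<circ> r) \<longlonglongrightarrow> L"
    by (rule seq_compactE) blast
  obtain m z where mz: "L = (m, z)" by (cases L)
  have lim: "(\<lambda>k. l (r k)) \<longlonglongrightarrow> m" "(\<lambda>k. y (r k)) \<longlonglongrightarrow> z"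
    using tendsto_fst[OF L(3)] tendsto_snd[OF L(3)] by (auto simp: mz comp_def)
  have m0: "m > 0" using L(1) N by (auto simp: mz) (smt (verit) divide_pos_pos)
  have Hl: "(\<lambda>k. H (w k)) \<longlonglongrightarrow> H w'" if "w \<longlonglongrightarrow> w'" for w w'
    using H that continuous_on_tendsto_compose[of UNIV H w w'] by simp
  \<comment> \<open>In the limit the excess 1 / (k + 1) disappears and one fixed atom z of weight m
    controls every h. The factors m and 1 / m cancel to first order, so the slope of H at z becomes
    the slope of the envelope at x.\<close>
  have bd: "convex_envelope H (x + h) \<le> convex_envelope H x + m * (H (z + h /\<^sub>R m) - H z)" for h
  proof (rule LIMSEQ_le_const)
    show "(\<lambda>k. convex_envelope H x + 1 / real (Suc (r k)) + l (r k) * (H (y (r k) + h /\<^sub>R l (r k)) - H (y (r k))))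
      \<longlonglongrightarrow> convex_envelope H x + m * (H (z + h /\<^sub>R m) - H z)"
    proof -
      have "(\<lambda>k. 1 / real (Suc (r k))) \<longlonglongrightarrow> 0"
        using LIMSEQ_subseq_LIMSEQ[OF LIMSEQ_inverse_real_of_nat L(2)] by (simp add: comp_def inverse_eq_divide)
      then have "(\<lambda>k. convex_envelope H x + 1 / real (Suc (r k)) + l (r k) * (H (y (r k) + h /\<^sub>R l (r k)) - H (y (r k))))
        \<longlonglongrightarrow> convex_envelope H x + 0 + m * (H (z + h /\<^sub>R m) - H z)"
        using m0 by (intro tendsto_intros Hl lim) auto
      then show ?thesis by simp
    qed
    show "\<exists>K. \<forall>k\<ge>K. convex_envelope H (x + h) \<le>
       convex_envelope H x + 1 / real (Suc (r k)) + l (r k) * (H (y (r k) + h /\<^sub>R l (r k)) - H (y (r k)))"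
    proof (intro exI allI impI)
      fix k
      show "convex_envelope H (x + h) \<le>
         convex_envelope H x + 1 / real (Suc (r k)) + l (r k) * (H (y (r k) + h /\<^sub>R l (r k)) - H (y (r k)))"
        using up[of h "r k"] t[of "r k"] by linarith
    qed
  qed
  obtain g where g: "superdiff H z g" using sd by blast
  have "superdiff (convex_envelope H) x g"
    unfolding superdiff_def
  proof (intro allI impI)
    fix e :: real assume "e > 0"
    then obtain d where d: "d > 0" "\<And>h. norm h < d \<Longrightarrow> H (z + h) \<le> H z + g \<bullet> h + e * norm h"
      using g superdiffD by metis
    show "\<exists>d>0. \<forall>h. norm h < d \<longrightarrow> convex_envelope H (x + h) \<le> convex_envelope H x + g \<bullet> h + e * norm h"
    proof (intro exI[of _ "m * d"] conjI allI impI)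
      fix h :: 'a assume "norm h < m * d"
      then have "norm (h /\<^sub>R m) < d" using m0 by (simp add: field_simps)
      then have "m * (H (z + h /\<^sub>R m) - H z) \<le> m * (g \<bullet> (h /\<^sub>R m) + e * norm (h /\<^sub>R m))"
        using d(2)[of "h /\<^sub>R m"] m0 by (intro mult_left_mono) auto
      also have "\<dots> = g \<bullet> h + e * norm h" using m0 by (simp add: field_simps)
      finally show "convex_envelope H (x + h) \<le> convex_envelope H x + g \<bullet> h + e * norm h"
        using bd[of h] by simp
    qed (use m0 d in auto)
  qed
  then show ?thesis by blast
qed

section \<open>Regularisation from above\<close>

lemma differentiable_superdiff:
  fixes F :: "'a::euclidean_space \<Rightarrow> real"
  assumes "F differentiable (at x)"
  shows "\<exists>g. superdiff F x g"
proof -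
  obtain D where D: "(F has_derivative D) (at x)" using assms unfolding differentiable_def by blast
  have "D = (\<lambda>h. h \<bullet> adjoint D 1)"
    using adjoint_works[OF has_derivative_linear[OF D], of _ 1] by auto
  with D have "GDERIV F x :> adjoint D 1" unfolding gderiv_def by simp
  then show ?thesis using superdiff_GDERIV by blast
qed

lemma superdiff_0_if_quadratic_bound:
  assumes bound: "\<And>h. K (x + h) \<le> K x + (norm h)\<^sup>2"
  shows "superdiff K x 0"
  unfolding superdiff_def
proof (intro allI impI)
  fix e :: real assume e: "e > 0"
  show "\<exists>d>0. \<forall>h. norm h < d \<longrightarrow> K (x + h) \<le> K x + 0 \<bullet> h + e * norm h"
  proof (intro exI[of _ e] conjI allI impI e)
    fix h :: 'a assume "norm h < e"
    then have "norm h * norm h \<le> e * norm h" by (intro mult_right_mono) auto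
    then show "K (x + h) \<le> K x + 0 \<bullet> h + e * norm h" using bound[of h] by (simp add: power2_eq_square)
  qed
qed

lemma superdiff_infdist_square:
  assumes "x \<in> C"
  shows "superdiff (\<lambda>y. (infdist y C)\<^sup>2) x 0"
proof (rule superdiff_0_if_quadratic_bound)
  fix h
  have "infdist (x + h) C \<le> norm h" using infdist_le[OF assms, of "x + h"] by (simp add: dist_norm)
  then have "(infdist (x + h) C)\<^sup>2 \<le> (norm h)\<^sup>2"
    by (intro power_mono) (auto simp: infdist_nonneg)
  then show "(infdist (x + h) C)\<^sup>2 \<le> (infdist x C)\<^sup>2 + (norm h)\<^sup>2"
    using zero_le_power2[of "infdist x C"] by linarith
qed

text \<open>H is the minimum of u plus a barrier around a centre y of variable radius
  \<open>rho y\<close>. Off C the barrier around an optimal centre is smooth near x and touches H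
  from above. On C the radius is 0, and H is squeezed between m and u, which agree there.\<close>

lemma superdiff_majorant:
  fixes m :: "'a::euclidean_space \<Rightarrow> real"
  assumes m: "continuous_on UNIV m" and low: "\<And>x. - b \<le> m x"
    and C: "closed C" "C \<noteq> {}" and sdC: "\<And>x. x \<in> C \<Longrightarrow> \<exists>g. superdiff m x g"
  obtains H where "continuous_on UNIV H" "\<And>x. \<exists>g. superdiff H x g" "\<And>x. m x \<le> H x" "\<And>x. x \<in> C \<Longrightarrow> H x = m x"
proof -
  define u where "u = (\<lambda>y. m y + (infdist y C)\<^sup>2)"
  have u: "continuous_on UNIV u" unfolding u_def by (intro continuous_intros m)
  have um: "m y \<le> u y" for y by (simp add: u_def)
  have uC: "u y = m y \<longleftrightarrow> y \<in> C" for y using C by (simp add: u_def in_closed_iff_infdist_zero)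
  \<comment> \<open>Z collects the bad pairs (x, y), for which the value of u at the centre y would
    not exceed m at x. Off C we have \<open>m y < u y\<close>, so the diagonal point (y, y) is at
    positive distance from the closed set Z.\<close>
  define Z where "Z = {p. u (snd p) \<le> m (fst p)}"
  have Z: "closed Z" unfolding Z_def
    by (intro closed_Collect_le continuous_on_compose2[OF u] continuous_on_compose2[OF m] continuous_intros) auto
  have Zne: "Z \<noteq> {}"
  proof -
    obtain c where "c \<in> C" using C by blast
    then have "(c, c) \<in> Z" using uC[of c] by (simp add: Z_def)
    then show ?thesis by blast
  qed
  \<comment> \<open>The distance is measured in the product, so a point x nearer to y than
    \<open>rho y\<close> forms no bad pair with it. The cap 1 keeps admissible centres
    bounded.\<close>
  define rho where "rho = (\<lambda>y. min 1 (infdist (y, y) Z))"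
  have rho_cont: "continuous_on UNIV rho" unfolding rho_def by (intro continuous_intros)
  have rho01: "0 \<le> rho y" "rho y \<le> 1" for y by (auto simp: rho_def infdist_nonneg)
  have rho0: "y \<in> C" if "rho y = 0" for y
  proof -
    have "infdist (y, y) Z = 0" using that by (auto simp: rho_def min_def split: if_splits)
    then have "(y, y) \<in> Z" using in_closed_iff_infdist_zero[OF Z Zne] by simp
    then show ?thesis using um[of y] uC[of y] by (simp add: Z_def)
  qed
  have rho_m: "m x \<le> u y" if "dist x y < rho y" for x y
  proof (rule ccontr)
    assume "\<not> m x \<le> u y"
    then have "(x, y) \<in> Z" by (simp add: Z_def)
    then have "infdist (y, y) Z \<le> dist (y, y) (x, y)" by (rule infdist_le)
    also have "\<dots> = dist x y" by (simp add: dist_Pair_Pair dist_commute)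
    finally show False using that by (simp add: rho_def)
  qed
  text \<open>For fixed \<^term>\<open>y\<close> the least admissible \<^term>\<open>s\<close> is
    \<open>|x - y|\<^sup>2 / (rho y\<^sup>2 - |x - y|\<^sup>2)\<close>, a smooth barrier on the ball of radius \<open>rho y\<close>;
    eliminating the quotient also covers the degenerate radius \<open>0\<close> on \<^term>\<open>C\<close>
    and makes the constraint closed.\<close>
  define A where "A = (\<lambda>x y s. 0 \<le> s \<and> (dist x y)\<^sup>2 * (1 + s) \<le> s * (rho y)\<^sup>2)"
  have A0: "A x x 0" for x by (simp add: A_def)
  have A_dist: "x = y \<or> dist x y < rho y" if "A x y s" for x y s
  proof (rule ccontr)
    assume *: "\<not> ?thesis"
    then have "(rho y)\<^sup>2 \<le> (dist x y)\<^sup>2" using rho01 by (intro power_mono) auto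
    then have "s * (rho y)\<^sup>2 \<le> s * (dist x y)\<^sup>2" using that by (intro mult_left_mono) (auto simp: A_def)
    moreover have "0 < (dist x y)\<^sup>2" using * by simp
    moreover have "(dist x y)\<^sup>2 + s * (dist x y)\<^sup>2 \<le> s * (rho y)\<^sup>2"
      using that by (simp add: A_def algebra_simps)
    ultimately show False by linarith
  qed
  have A_m: "m x \<le> u y" if "A x y s" for x y s
    using A_dist[OF that] rho_m um by auto
  have A_ball: "dist x y \<le> 1" if "A x y s" for x y s
    using A_dist[OF that] rho01[of y] by auto
  have A_closed: "closed {(x, y, s). A x y s}"
  proof -
    have "{(x, y, s). A x y s} = {p. 0 \<le> snd (snd p)} \<inter>
        {p. (dist (fst p) (fst (snd p)))\<^sup>2 * (1 + snd (snd p)) \<le> snd (snd p) * (rho (fst (snd p)))\<^sup>2}"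
      by (auto simp: A_def)
    also have "closed \<dots>"
      by (intro closed_Int closed_Collect_le continuous_on_compose2[OF rho_cont] continuous_intros) auto
    finally show ?thesis .
  qed
  have A_lim: "A x y s" if "\<And>k. A (X k) (Y k) (S k)" "X \<longlonglongrightarrow> x" "Y \<longlonglongrightarrow> y" "S \<longlonglongrightarrow> s" for X Y S x y s
  proof -
    have "(\<lambda>k. (X k, Y k, S k)) \<longlonglongrightarrow> (x, y, s)" by (intro tendsto_Pair that)
    from closed_sequentially[OF A_closed _ this] that(1) show ?thesis by simp
  qed
  \<comment> \<open>One compactness argument with two uses: a constant sequence X gives existence of
    a minimiser, a varying one gives closed sublevel sets of H.\<close>
  have A_sub: "\<exists>y s. A x y s \<and> u y + s \<le> c'"
    if A: "\<And>k. A (X k) (Y k) (S k)" and X: "X \<longlonglongrightarrow> x" and le: "\<And>k. u (Y k) + S k \<le> c k" and c: "c \<longlonglongrightarrow> c'"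
    for X Y S x c c'
  proof -
    obtain B where B: "\<And>k. norm (X k) \<le> B"
      using convergent_imp_Bseq[OF convergentI[OF X]] unfolding Bseq_def by blast
    obtain c0 where c0: "\<And>k. norm (c k) \<le> c0"
      using convergent_imp_Bseq[OF convergentI[OF c]] unfolding Bseq_def by blast
    define Q where "Q = cball (0::'a) (B + 1) \<times> {0..c0 + b}"
    have inQ: "\<forall>k. (Y k, S k) \<in> Q"
    proof
      fix k
      have "norm (Y k) \<le> norm (X k) + dist (X k) (Y k)"
        using norm_triangle_ineq4[of "X k" "X k - Y k"] by (simp add: dist_norm)
      then have "norm (Y k) \<le> B + 1" using A_ball[OF A[of k]] B[of k] by linarith
      moreover have "S k \<le> c0 + b" using le[of k] um[of "Y k"] low[of "Y k"] c0[of k] by simp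
      ultimately show "(Y k, S k) \<in> Q" using A[of k] by (simp add: Q_def A_def)
    qed
    have "seq_compact Q"
      unfolding Q_def by (simp add: compact_Times flip: compact_eq_seq_compact_metric)
    then obtain L and r :: "nat \<Rightarrow> nat" where
      L: "strict_mono r" "((\<lambda>k. (Y k, S k)) \<circ> r) \<longlonglongrightarrow> L"
      using inQ by (rule seq_compactE) blast
    obtain y s where ys: "L = (y, s)" by (cases L)
    have lim: "(\<lambda>k. Y (r k)) \<longlonglongrightarrow> y" "(\<lambda>k. S (r k)) \<longlonglongrightarrow> s"
      using tendsto_fst[OF L(2)] tendsto_snd[OF L(2)] by (auto simp: ys comp_def)
    have lim': "(\<lambda>k. X (r k)) \<longlonglongrightarrow> x" "(\<lambda>k. c (r k)) \<longlonglongrightarrow> c'"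
      using LIMSEQ_subseq_LIMSEQ[OF X L(1)] LIMSEQ_subseq_LIMSEQ[OF c L(1)] by (auto simp: comp_def)
    have "A x y s" by (rule A_lim[OF A lim'(1) lim])
    moreover have "(\<lambda>k. u (Y (r k)) + S (r k)) \<longlonglongrightarrow> u y + s"
      using u lim continuous_on_tendsto_compose[of UNIV u _ y] by (intro tendsto_add) auto
    then have "u y + s \<le> c'" by (rule LIMSEQ_le[OF _ lim'(2)]) (use le in blast)
    ultimately show ?thesis by blast
  qed
  have A_min: "\<exists>y s. A x y s \<and> (\<forall>y' s'. A x y' s' \<longrightarrow> u y + s \<le> u y' + s')" for x
  proof -
    define V where "V = {u y + s | y s. A x y s}"
    have V: "V \<noteq> {}" "bdd_below V"
    proof -
      show "V \<noteq> {}" using A0 by (auto simp: V_def)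
      have "- b \<le> u y + s" if "A x y s" for y s
        using that um[of y] low[of y] by (simp add: A_def)
      then show "bdd_below V" unfolding V_def by (auto intro!: bdd_belowI[of _ "- b"])
    qed
    have "\<exists>p. A x (fst p) (snd p) \<and> u (fst p) + snd p \<le> Inf V + 1 / real (Suc k)" for k
    proof -
      obtain v where "v \<in> V" "v < Inf V + 1 / real (Suc k)"
        using cInf_lessD[OF V(1), of "Inf V + 1 / real (Suc k)"] by auto
      then show ?thesis by (force simp: V_def)
    qed
    then obtain p where p: "\<And>k. A x (fst (p k)) (snd (p k)) \<and> u (fst (p k)) + snd (p k) \<le> Inf V + 1 / real (Suc k)"
      by metis
    have "(\<lambda>k. Inf V + 1 / real (Suc k)) \<longlonglongrightarrow> Inf V + 0"
      using LIMSEQ_inverse_real_of_nat by (intro tendsto_intros) (simp add: inverse_eq_divide)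
    then have lim: "(\<lambda>k. Inf V + 1 / real (Suc k)) \<longlonglongrightarrow> Inf V" by simp
    have "\<exists>y s. A x y s \<and> u y + s \<le> Inf V"
      by (rule A_sub[OF conjunct1[OF p] tendsto_const conjunct2[OF p] lim])
    then obtain y s where ys: "A x y s" "u y + s \<le> Inf V" by blast
    have "Inf V \<le> u y' + s'" if "A x y' s'" for y' s'
      by (rule cInf_lower[OF _ V(2)]) (use that in \<open>auto simp: V_def\<close>)
    with ys show ?thesis using order_trans[OF ys(2)] by blast
  qed
  define P where "P = (\<lambda>x y s. A x y s \<and> (\<forall>y' s'. A x y' s' \<longrightarrow> u y + s \<le> u y' + s'))"
  have "\<exists>y s. P x y s" for x unfolding P_def by (rule A_min)
  then obtain Y S where P: "\<And>x. P x (Y x) (S x)" by metis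
  have AYS: "A x (Y x) (S x)" and min: "A x y s \<Longrightarrow> u (Y x) + S x \<le> u y + s" for x y s
    using P[of x] by (auto simp: P_def)
  define H where "H = (\<lambda>x. u (Y x) + S x)"
  have Hu: "H x \<le> u x" for x using min[OF A0[of x]] by (simp add: H_def)
  have mH: "m x \<le> H x" for x using A_m[OF AYS[of x]] AYS[of x] by (simp add: H_def A_def)
  have sdH: "\<exists>g. superdiff H x g" for x
  proof (cases "x \<in> C")
    case True
    then obtain g where "superdiff m x g" using sdC by blast
    then have "superdiff u x (g + 0)"
      unfolding u_def by (rule superdiff_add[OF _ superdiff_infdist_square[OF True]])
    then have "superdiff H x (g + 0)"
      by (rule superdiff_upper_touch) (use Hu mH[of x] uC[of x] True in auto)
    then show ?thesis by blast
  next
    case False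
    define y where "y = Y x"
    define r where "r = rho y"
    have r: "dist x y < r" "r > 0"
    proof -
      have A: "(dist x y)\<^sup>2 * (1 + S x) \<le> S x * r\<^sup>2" using AYS[of x] by (simp add: A_def y_def r_def)
      have "S x \<ge> 0" using AYS[of x] by (simp add: A_def)
      have "r \<noteq> 0"
      proof
        assume "r = 0"
        then have "y \<in> C" using rho0 by (simp add: r_def)
        moreover have "x = y"
          using A \<open>r = 0\<close> \<open>S x \<ge> 0\<close> by (auto simp: mult_le_0_iff)
        ultimately show False using False by simp
      qed
      then show "r > 0" using rho01[of y] by (simp add: r_def)
      then show "dist x y < r" using A_dist[OF AYS[of x]] by (auto simp: y_def r_def)
    qed
    \<comment> \<open>The optimal centre y is frozen and s takes its least admissible value, so bar
      is smooth on the ball and is a competitor for H at every point of it.\<close>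
    define bar where "bar = (\<lambda>z. u y + ((z - y) \<bullet> (z - y)) / (r\<^sup>2 - (z - y) \<bullet> (z - y)))"
    have inner: "(z - y) \<bullet> (z - y) = (dist z y)\<^sup>2" for z by (simp add: dist_norm power2_norm_eq_inner)
    have pos: "r\<^sup>2 - (dist z y)\<^sup>2 > 0" if "dist z y < r" for z
      using that by (simp add: power_strict_mono)
    have "bar differentiable (at x)"
    proof -
      have "r\<^sup>2 - (x - y) \<bullet> (x - y) \<noteq> 0" using pos[OF r(1)] unfolding inner by simp
      then show ?thesis unfolding bar_def
        by (intro differentiable_add differentiable_divide differentiable_diff differentiable_inner
            differentiable_const differentiable_ident)
    qed
    then obtain g where "superdiff bar x g" using differentiable_superdiff by blast
    moreover have "\<forall>\<^sub>F z in nhds x. H z \<le> bar z"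
    proof -
      have "H z \<le> bar z" if "dist z y < r" for z
      proof -
        have "A z y ((dist z y)\<^sup>2 / (r\<^sup>2 - (dist z y)\<^sup>2))"
          using pos[OF that] by (simp add: A_def field_simps flip: r_def)
        from min[OF this] show ?thesis by (simp add: H_def bar_def inner)
      qed
      moreover have "\<forall>\<^sub>F z in nhds x. z \<in> ball y r"
        using r by (intro eventually_nhds_in_open) (auto simp: dist_commute)
      ultimately show ?thesis by (auto simp: dist_commute elim: eventually_mono)
    qed
    moreover have "bar x \<le> H x"
    proof -
      have "(dist x y)\<^sup>2 \<le> S x * (r\<^sup>2 - (dist x y)\<^sup>2)"
        using AYS[of x] by (simp add: A_def r_def y_def algebra_simps)
      then have "(dist x y)\<^sup>2 / (r\<^sup>2 - (dist x y)\<^sup>2) \<le> S x" using pos[OF r(1)] by (simp add: pos_divide_le_eq)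
      then show ?thesis unfolding bar_def inner by (simp add: H_def y_def)
    qed
    ultimately show ?thesis using superdiff_upper_touch by blast
  qed
  \<comment> \<open>Lower semicontinuity comes from closed sublevel sets, upper semicontinuity from
    the upper expansions.\<close>
  have "continuous_on UNIV H"
  proof -
    have cl: "closed {x. H x \<le> c}" for c
      unfolding closed_sequential_limits
    proof (intro allI impI, elim conjE)
      fix X x assume X: "\<forall>k. X k \<in> {x. H x \<le> c}" "X \<longlonglongrightarrow> x"
      obtain y s where "A x y s" "u y + s \<le> c"
        using A_sub[OF AYS X(2), of "\<lambda>_. c" c] X(1) by (auto simp: H_def)
      then show "x \<in> {x. H x \<le> c}" using min[of x y s] by (simp add: H_def)
    qed
    have "(H \<longlongrightarrow> H x) (nhds x)" for x
    proof (rule order_tendstoI)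
      fix c assume "c < H x"
      then show "\<forall>\<^sub>F z in nhds x. c < H z"
        using eventually_nhds_in_open[of "- {x. H x \<le> c}" x] cl[of c] by (simp add: open_Compl not_le)
    next
      fix c assume "H x < c"
      then show "\<forall>\<^sub>F z in nhds x. H z < c"
        using sdH[of x] superdiff_usc[of H x _ "c - H x"] by auto
    qed
    then show ?thesis
      by (simp add: continuous_on_def tendsto_at_iff_tendsto_nhds)
  qed
  moreover have "H x = m x" if "x \<in> C" for x
    using Hu[of x] mH[of x] uC[of x] that by simp
  ultimately show thesis using that sdH mH by blast
qed

text \<open>Passing from H to its envelope cannot push the values below the convex function m, and
  on C it starts from H = m; thus the values on C survive.\<close>

lemma coercive_convex_C1_majorant:
  fixes m :: "'a::euclidean_space \<Rightarrow> real"
  assumes cv: "convex_on UNIV m" and a: "a > 0" and low: "\<And>x. a * norm x - b \<le> m x"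
    and C: "closed C" "C \<noteq> {}" and sdC: "\<And>x. x \<in> C \<Longrightarrow> \<exists>g. superdiff m x g"
  obtains F where "convex_on UNIV F" "\<And>x. \<exists>g. superdiff F x g" "\<And>x. m x \<le> F x" "\<And>x. x \<in> C \<Longrightarrow> F x = m x"
proof -
  have m: "continuous_on UNIV m" using convex_on_continuous[OF open_UNIV cv] .
  have "- b \<le> m x" for x using low[of x] mult_nonneg_nonneg[of a "norm x"] less_imp_le[OF a] norm_ge_zero[of x] by linarith
  from superdiff_majorant[OF m this C sdC]
  obtain H where H: "continuous_on UNIV H" "\<And>x. \<exists>g. superdiff H x g" "\<And>x. m x \<le> H x" "\<And>x. x \<in> C \<Longrightarrow> H x = m x"
    by metis
  show thesis
  proof (rule that)
    show "convex_on UNIV (convex_envelope H)" by (rule convex_on_convex_envelope[OF cv H(3)])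
    show "\<exists>g. superdiff (convex_envelope H) x g" for x
      by (rule superdiff_convex_envelope[OF H(1,2) a]) (use low H(3) order_trans in blast)
    show "m x \<le> convex_envelope H x" for x by (rule convex_envelope_ge[OF cv H(3)])
    then show "convex_envelope H x = m x" if "x \<in> C" for x
      using convex_envelope_le[OF cv H(3) graph_in_hull_epigraph[OF order_refl]] H(4)[OF that]
      by (metis order_antisym)
  qed
qed

section \<open>Suprema of affine functions\<close>

lemma orth_proj_eq: "subspace X \<Longrightarrow> x \<in> X \<Longrightarrow> orth_proj X x = x"
  by (rule orth_proj_unique) auto

lemma orth_proj_inner:
  fixes X :: "'a::euclidean_space set"
  assumes "subspace X" "u \<in> X"
  shows "u \<bullet> orth_proj X x = u \<bullet> x"
proof -
  have "(x - orth_proj X x) \<bullet> u = 0" using orth_proj(2)[OF assms(1)] assms(2) by blast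
  then have "orth_proj X x \<bullet> u = x \<bullet> u" by (simp add: inner_diff_left)
  then show ?thesis by (simp add: inner_commute)
qed

lemma linear_orth_proj:
  fixes X :: "'a::euclidean_space set"
  assumes X: "subspace X"
  shows "linear (orth_proj X)"
proof (rule linearI)
  note P = orth_proj[OF X]
  show "orth_proj X (x + y) = orth_proj X x + orth_proj X y" for x y
    by (rule orth_proj_unique[OF X subspace_add[OF X P(1) P(1)]])
      (use P(2)[of x] P(2)[of y] in \<open>simp add: inner_diff_left inner_add_left\<close>)
  show "orth_proj X (c *\<^sub>R x) = c *\<^sub>R orth_proj X x" for c x
    by (rule orth_proj_unique[OF X subspace_scale[OF X P(1)]])
      (use P(2)[of x] in \<open>simp add: inner_diff_left\<close>)
qed

lemma norm_orth_proj_Pythagoras: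
  fixes X :: "'a::euclidean_space set"
  assumes X: "subspace X"
  shows "(norm x)\<^sup>2 = (norm (orth_proj X x))\<^sup>2 + (norm (x - orth_proj X x))\<^sup>2"
proof -
  have "(x - orth_proj X x) \<bullet> orth_proj X x = 0" using orth_proj[OF X] by blast
  then show ?thesis by (simp add: power2_norm_eq_inner inner_diff inner_commute)
qed

lemma norm_orth_proj_le:
  fixes X :: "'a::euclidean_space set"
  assumes "subspace X"
  shows "norm (orth_proj X x) \<le> norm x" "norm (x - orth_proj X x) \<le> norm x"
proof -
  note eq = norm_orth_proj_Pythagoras[OF assms, of x]
  show "norm (orth_proj X x) \<le> norm x" by (rule power2_le_imp_le) (simp_all add: eq)
  show "norm (x - orth_proj X x) \<le> norm x" by (rule power2_le_imp_le) (simp_all add: eq)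
qed

lemma convex_on_affine_envelope:
  fixes m :: "'a::euclidean_space \<Rightarrow> real"
  assumes ge: "\<And>z y. z \<in> E \<Longrightarrow> c z + G z \<bullet> y \<le> m y"
    and approx: "\<And>y e. e > 0 \<Longrightarrow> \<exists>z\<in>E. m y - e < c z + G z \<bullet> y"
  shows "convex_on UNIV m"
proof (rule convex_onI)
  fix t :: real and x y assume t: "0 < t" "t < 1"
  show "m ((1 - t) *\<^sub>R x + t *\<^sub>R y) \<le> (1 - t) * m x + t * m y"
  proof (rule field_le_epsilon)
    fix e :: real assume "e > 0"
    then obtain z where z: "z \<in> E" "m ((1 - t) *\<^sub>R x + t *\<^sub>R y) - e < c z + G z \<bullet> ((1 - t) *\<^sub>R x + t *\<^sub>R y)"
      using approx by blast
    have "c z + G z \<bullet> ((1 - t) *\<^sub>R x + t *\<^sub>R y) = (1 - t) * (c z + G z \<bullet> x) + t * (c z + G z \<bullet> y)"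
      by (simp add: inner_add_right algebra_simps)
    also have "\<dots> \<le> (1 - t) * m x + t * m y"
      using ge[OF z(1)] t by (intro add_mono mult_left_mono) auto
    finally show "m ((1 - t) *\<^sub>R x + t *\<^sub>R y) \<le> (1 - t) * m x + t * m y + e" using z(2) by linarith
  qed
qed auto

text \<open>One unit step along \<open>G z\<close> raises its plane by \<open>norm (G z)\<close>. A
  plane nearly active at w starts above -M - 1 and must stay below m, hence below M, on the ball of
  radius 2; this gives the bound 2M + 1.\<close>

lemma affine_envelope_slopes_bounded:
  fixes m :: "'a::euclidean_space \<Rightarrow> real"
  assumes m: "continuous_on UNIV m" and ge: "\<And>z y. z \<in> E \<Longrightarrow> c z + G z \<bullet> y \<le> m y"
  obtains N where "\<And>z w. z \<in> E \<Longrightarrow> dist y w \<le> 1 \<Longrightarrow> m w - 1 < c z + G z \<bullet> w \<Longrightarrow> norm (G z) \<le> N"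
proof -
  have "bounded (m ` cball y 2)"
    by (intro compact_imp_bounded compact_continuous_image continuous_on_subset[OF m]) auto
  then obtain M where M: "\<And>w. dist y w \<le> 2 \<Longrightarrow> \<bar>m w\<bar> \<le> M" unfolding bounded_iff by force
  show thesis
  proof (rule that)
    fix z w assume z: "z \<in> E" and w: "dist y w \<le> 1" "m w - 1 < c z + G z \<bullet> w"
    define w' where "w' = w + sgn (G z)"
    have "dist w w' \<le> 1" by (simp add: w'_def dist_norm norm_sgn)
    then have "dist y w' \<le> 2" using dist_triangle[of y w' w] w by linarith
    then have "c z + G z \<bullet> w' \<le> M" using ge[OF z, of w'] M[of w'] by linarith
    moreover have "- M \<le> m w" using M[of w] w(1) by linarith
    moreover have "G z \<bullet> w' = G z \<bullet> w + norm (G z)"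
      by (cases "G z = 0"; simp add: w'_def inner_add_right sgn_div_norm power2_norm_eq_inner[symmetric] power2_eq_square)
    ultimately show "norm (G z) \<le> 2 * M + 1" using w by linarith
  qed
qed

text \<open>A plane that is active at y + h up to e/2 times \<open>norm h\<close> is also nearly
  active at y, so its slope is within e/2 of g. Its value at y is at most \<open>m y\<close>, and
  the two errors add up to e times \<open>norm h\<close>.\<close>

lemma superdiff_affine_envelope:
  fixes m :: "'a::euclidean_space \<Rightarrow> real"
  assumes m: "continuous_on UNIV m" and ge: "\<And>z y. z \<in> E \<Longrightarrow> c z + G z \<bullet> y \<le> m y"
    and approx: "\<And>y e. e > 0 \<Longrightarrow> \<exists>z\<in>E. m y - e < c z + G z \<bullet> y"
    and active: "\<And>e. e > 0 \<Longrightarrow> \<exists>d>0. \<forall>z\<in>E. m y - d < c z + G z \<bullet> y \<longrightarrow> norm (G z - g) \<le> e"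
  shows "superdiff m y g"
  unfolding superdiff_def
proof (intro allI impI)
  fix e :: real assume e: "e > 0"
  obtain N where N: "\<And>z w. z \<in> E \<Longrightarrow> dist y w \<le> 1 \<Longrightarrow> m w - 1 < c z + G z \<bullet> w \<Longrightarrow> norm (G z) \<le> N"
    by (rule affine_envelope_slopes_bounded[of m E c G y, OF m ge]) blast+
  obtain d where d: "d > 0" "\<And>z. z \<in> E \<Longrightarrow> m y - d < c z + G z \<bullet> y \<Longrightarrow> norm (G z - g) \<le> e / 2"
    using active[of "e / 2"] e by auto
  have "isCont m y" using m by (simp add: continuous_on_eq_continuous_at)
  then obtain d1 where d1: "d1 > 0" "\<And>w. dist w y < d1 \<Longrightarrow> dist (m w) (m y) < d / 3"
    using d(1) unfolding continuous_at_eps_delta by (metis divide_pos_pos zero_less_numeral)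
  \<comment> \<open>K dominates both the slopes near y and e / 2. The radius r then makes the slack,
    the change of m and the change of the plane at most d / 3 each, which together cost d.\<close>
  define K where "K = \<bar>N\<bar> + e + 1"
  have K: "K > 0" using e by (simp add: K_def)
  define r where "r = Min {1, d1, d / (3 * K), 1 / K}"
  have r: "r > 0" "r \<le> 1" "r \<le> d1" "r \<le> d / (3 * K)" "r \<le> 1 / K" using d1 d K by (auto simp: r_def)
  show "\<exists>d>0. \<forall>h. norm h < d \<longrightarrow> m (y + h) \<le> m y + g \<bullet> h + e * norm h"
  proof (intro exI[of _ r] conjI allI impI r(1))
    fix h :: 'a assume h: "norm h < r"
    show "m (y + h) \<le> m y + g \<bullet> h + e * norm h"
    proof (cases "h = 0")
      case False
      then have "e / 2 * norm h > 0" using e by simp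
      then obtain z where z: "z \<in> E" "m (y + h) - e / 2 * norm h < c z + G z \<bullet> (y + h)"
        using approx by blast
      have Kh: "K * norm h \<le> 1" "K * norm h \<le> d / 3"
        using mult_left_mono[of "norm h" "1 / K" K] mult_left_mono[of "norm h" "d / (3 * K)" K] K r h
        by auto
      have eh: "e / 2 * norm h \<le> K * norm h" using e by (intro mult_right_mono) (auto simp: K_def)
      have Gz: "norm (G z) \<le> N" by (rule N[OF z(1), of "y + h"]) (use h r z eh Kh in \<open>auto simp: dist_norm\<close>)
      have "\<bar>G z \<bullet> h\<bar> \<le> norm (G z) * norm h" by (rule Cauchy_Schwarz_ineq2)
      also have "\<dots> \<le> K * norm h" using Gz e by (intro mult_right_mono) (auto simp: K_def)
      finally have "\<bar>G z \<bullet> h\<bar> \<le> d / 3" using Kh by simp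
      moreover have "\<bar>m (y + h) - m y\<bar> < d / 3"
        using d1(2)[of "y + h"] h r by (simp add: dist_norm)
      ultimately have "m y - d < c z + G z \<bullet> y"
        using z(2) eh Kh(2) unfolding inner_add_right abs_le_iff abs_less_iff by linarith
      then have "norm (G z - g) \<le> e / 2" using d z by blast
      then have "(G z - g) \<bullet> h \<le> e / 2 * norm h"
        using norm_cauchy_schwarz[of "G z - g" h] mult_right_mono[of "norm (G z - g)" "e / 2" "norm h"] by simp
      then show ?thesis using z ge[OF z(1), of y] by (simp add: inner_add_right inner_diff_left)
    qed simp
  qed
qed

lemma finite_spanning_differences:
  fixes E :: "'b set" and G :: "'b \<Rightarrow> 'a::euclidean_space"
  assumes "E \<noteq> {}"
  obtains S where "finite S" "S \<noteq> {}" "S \<subseteq> E"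
    "span {G x - G y | x y. x \<in> S \<and> y \<in> S} = span {G x - G y | x y. x \<in> E \<and> y \<in> E}"
proof -
  define V where "V = {G x - G y | x y. x \<in> E \<and> y \<in> E}"
  obtain B where B: "B \<subseteq> V" "independent B" "V \<subseteq> span B" using maximal_independent_subset by blast
  have "B \<subseteq> (\<lambda>(x, y). G x - G y) ` (E \<times> E)" using B(1) by (auto simp: V_def)
  then obtain Q where Q: "Q \<subseteq> E \<times> E" "finite Q" "B = (\<lambda>(x, y). G x - G y) ` Q"
    using finite_subset_image[OF independent_imp_finite[OF B(2)]] by metis
  obtain x0 where x0: "x0 \<in> E" using assms by blast
  \<comment> \<open>The point x0 keeps S nonempty when all gradients coincide and B is
    empty.\<close>
  define S where "S = insert x0 (fst ` Q \<union> snd ` Q)"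
  have S: "S \<subseteq> E" using Q(1) x0 by (auto simp: S_def)
  show thesis
  proof (rule that)
    show "finite S" "S \<noteq> {}" using Q by (auto simp: S_def)
    have "B \<subseteq> {G x - G y | x y. x \<in> S \<and> y \<in> S}" unfolding Q(3) S_def by force
    then have "V \<subseteq> span {G x - G y | x y. x \<in> S \<and> y \<in> S}" using B(3) span_mono by blast
    moreover have "{G x - G y | x y. x \<in> S \<and> y \<in> S} \<subseteq> V" using S by (auto simp: V_def)
    ultimately show "span {G x - G y | x y. x \<in> S \<and> y \<in> S} = span {G x - G y | x y. x \<in> E \<and> y \<in> E}"
      unfolding V_def[symmetric] by (intro antisym span_mono span_minimal subspace_span)
  qed (rule S)
qed

section \<open>Extension from gradients spanning the subspace\<close>

text \<open>A vector of X orthogonal to all generators is 0, so the sum is positive on the unit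
  sphere of X and has a positive minimum there; homogeneity does the rest. The sphere is empty when
  X is {0}.\<close>

lemma coercive_on_span:
  fixes G :: "'b \<Rightarrow> 'a::euclidean_space"
  assumes S: "finite S" and X: "X = span (G ` S)"
  obtains c where "c > 0" "\<And>x. c * norm (orth_proj X x) \<le> (\<Sum>z\<in>S. \<bar>G z \<bullet> x\<bar>)"
proof -
  have sX: "subspace X" by (simp add: X)
  have GX: "G z \<in> X" if "z \<in> S" for z using that by (simp add: X span_base)
  define phi where "phi = (\<lambda>y. \<Sum>z\<in>S. \<bar>G z \<bullet> y\<bar>)"
  have phi0: "phi y \<ge> 0" for y unfolding phi_def by (intro sum_nonneg) auto
  define K where "K = sphere 0 1 \<inter> X"
  have K: "compact K" unfolding K_def by (intro compact_Int_closed closed_subspace sX) auto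
  have cont: "continuous_on K phi" unfolding phi_def by (intro continuous_intros)
  have "\<exists>c>0. \<forall>y\<in>K. c \<le> phi y"
  proof (cases "K = {}")
    case False
    then obtain y where y: "y \<in> K" "\<And>w. w \<in> K \<Longrightarrow> phi y \<le> phi w"
      using continuous_attains_inf[OF K _ cont] by blast
    have "phi y \<noteq> 0"
    proof
      assume "phi y = 0"
      then have *: "G z \<bullet> y = 0" if "z \<in> S" for z
        using that S by (simp add: phi_def sum_nonneg_eq_0_iff)
      have "orthogonal y y"
        by (rule orthogonal_to_span[of y "G ` S"]) (use y(1) * in \<open>auto simp: K_def X orthogonal_def inner_commute\<close>)
      then show False using y(1) by (auto simp: K_def orthogonal_def)
    qed
    then show ?thesis using phi0[of y] y by (intro exI[of _ "phi y"]) auto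
  qed (auto intro: exI[of _ 1])
  then obtain c where c: "c > 0" "\<And>y. y \<in> K \<Longrightarrow> c \<le> phi y" by blast
  show thesis
  proof (rule that[OF c(1)])
    fix x
    define p where "p = orth_proj X x"
    have pX: "p \<in> X" using orth_proj[OF sX] by (simp add: p_def)
    have "c * norm p \<le> phi p"
    proof (cases "p = 0")
      case False
      define q where "q = p /\<^sub>R norm p"
      have "q \<in> K" using pX False sX by (simp add: K_def q_def subspace_scale)
      then have "c * norm p \<le> phi q * norm p" using c by (intro mult_right_mono) auto
      also have "\<dots> = phi p"
        using False by (simp add: phi_def q_def abs_mult sum_distrib_right divide_simps)
      finally show ?thesis .
    qed (simp add: phi0)
    also have "phi p = (\<Sum>z\<in>S. \<bar>G z \<bullet> x\<bar>)"
      unfolding phi_def p_def by (intro sum.cong refl) (simp add: orth_proj_inner[OF sX GX])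
    finally show "c * norm (orth_proj X x) \<le> (\<Sum>z\<in>S. \<bar>G z \<bullet> x\<bar>)" by (simp add: p_def)
  qed
qed

lemma convex_on_norm_square_linear:
  fixes L :: "'a::real_normed_vector \<Rightarrow> 'b::real_inner"
  assumes "linear L"
  shows "convex_on UNIV (\<lambda>x. (norm (L x))\<^sup>2)"
proof (rule convex_onI)
  fix t :: real and x y assume t: "0 < t" "t < 1"
  have L: "L ((1 - t) *\<^sub>R x + t *\<^sub>R y) = (1 - t) *\<^sub>R L x + t *\<^sub>R L y"
    using assms by (simp only: linear_add linear_scale)
  have "(1 - t) * (norm (L x))\<^sup>2 + t * (norm (L y))\<^sup>2 - (norm (L ((1 - t) *\<^sub>R x + t *\<^sub>R y)))\<^sup>2
      = t * (1 - t) * (norm (L x - L y))\<^sup>2"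
    unfolding L by (simp add: power2_norm_eq_inner inner_add inner_diff inner_commute[of "L y" "L x"] algebra_simps)
  also have "\<dots> \<ge> 0" using t by simp
  finally show "(norm (L ((1 - t) *\<^sub>R x + t *\<^sub>R y)))\<^sup>2 \<le> (1 - t) * (norm (L x))\<^sup>2 + t * (norm (L y))\<^sup>2"
    by linarith
qed auto

text \<open>The hypothesis \<open>S0\<close> gives coercivity of m on X, \<open>GX\<close> its
  invariance under P, \<open>fin\<close> its finiteness, and \<open>close\<close>, a uniform form of
  (iv), its upper expansions on C.\<close>

lemma convex_C1_extension_centered:
  fixes E :: "'a::euclidean_space set"
  assumes S: "finite S" "S \<noteq> {}" "S \<subseteq> E" and S0: "(\<Sum>z\<in>S. G z) = 0"
    and X: "X = span (G ` S)" and GX: "\<And>z. z \<in> E \<Longrightarrow> G z \<in> X"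
    and ineq: "\<And>x y. x \<in> E \<Longrightarrow> y \<in> E \<Longrightarrow> f y + G y \<bullet> (x - y) \<le> f x"
    and fin: "\<And>y. \<exists>c. \<forall>z\<in>E. f z + G z \<bullet> (y - z) \<le> c"
    and close: "\<And>N e. e > 0 \<Longrightarrow> \<exists>d>0. \<forall>x\<in>E. \<forall>z\<in>E. norm (orth_proj X x) \<le> N \<longrightarrow> norm (G z) \<le> N \<longrightarrow>
        f x - f z - G z \<bullet> (x - z) < d \<longrightarrow> norm (G x - G z) \<le> e"
  obtains F where "convex_on UNIV F" "\<And>x. \<exists>g. superdiff F x g" "\<And>x. x \<in> E \<Longrightarrow> F x = f x"
    "\<And>x y. x \<in> E \<Longrightarrow> f x + G x \<bullet> (y - x) \<le> F y"
proof -
  have sX: "subspace X" by (simp add: X)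
  define P where "P = orth_proj X"
  have P: "linear P" "\<And>x. P x \<in> X" "\<And>x. x \<in> X \<Longrightarrow> P x = x" "\<And>u x. u \<in> X \<Longrightarrow> u \<bullet> P x = u \<bullet> x"
    "\<And>x. norm (P x) \<le> norm x" "\<And>x. norm (x - P x) \<le> norm x"
    using linear_orth_proj[OF sX] orth_proj(1)[OF sX] orth_proj_eq[OF sX] orth_proj_inner[OF sX]
      norm_orth_proj_le[OF sX] by (auto simp: P_def)
  define c where "c = (\<lambda>z. f z - G z \<bullet> z)"
  define m where "m = (\<lambda>y. SUP z\<in>E. c z + G z \<bullet> y)"
  have E: "E \<noteq> {}" using S by blast
  have bdd: "bdd_above ((\<lambda>z. c z + G z \<bullet> y) ` E)" for y
  proof -
    obtain C where "\<forall>z\<in>E. f z + G z \<bullet> (y - z) \<le> C" using fin by blast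
    then show ?thesis by (intro bdd_aboveI[of _ C]) (auto simp: c_def inner_diff_right algebra_simps)
  qed
  have ge: "c z + G z \<bullet> y \<le> m y" if "z \<in> E" for z y
    unfolding m_def by (rule cSUP_upper[OF that bdd])
  have approx: "\<exists>z\<in>E. m y - e < c z + G z \<bullet> y" if "e > 0" for y e
    using less_cSUP_iff[OF E bdd, of "m y - e" y] that by (simp add: m_def)
  have cv: "convex_on UNIV m" by (rule convex_on_affine_envelope[OF ge approx])
  have cont: "continuous_on UNIV m" by (rule convex_on_continuous[OF open_UNIV cv])
  have mf: "m x = f x" if "x \<in> E" for x
  proof (rule antisym)
    show "m x \<le> f x" unfolding m_def
      by (rule cSUP_least[OF E]) (use ineq[OF that] in \<open>simp add: c_def inner_diff_right algebra_simps\<close>)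
    show "f x \<le> m x" using ge[OF that, of x] by (simp add: c_def)
  qed
  have mP: "m (P y) = m y" for y
    unfolding m_def by (rule SUP_cong) (simp_all add: P(4)[OF GX])
  obtain a b where a: "a > 0" and low: "\<And>x. a * norm (P x) - b \<le> m x"
  proof -
    obtain k where k: "k > 0" "\<And>x. k * norm (P x) \<le> (\<Sum>z\<in>S. \<bar>G z \<bullet> x\<bar>)"
      using coercive_on_span[OF S(1) X] unfolding P_def by metis
    define n where "n = real (card S)"
    have n: "n > 0" using S by (simp add: n_def card_gt_0_iff)
    define b where "b = (\<Sum>z\<in>S. \<bar>c z\<bar>)"
    have "k / (2 * n) * norm (P x) - b \<le> m x" for x
    proof -
      have le: "G z \<bullet> x \<le> m x + b" if "z \<in> S" for z
      proof -
        have "\<bar>c z\<bar> \<le> b" unfolding b_def using S(1) that by (intro member_le_sum) auto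
        then show ?thesis using ge[of z x] that S(3) by (auto simp: abs_le_iff)
      qed
      have sum0: "(\<Sum>z\<in>S. G z \<bullet> x) = 0" by (simp add: S0 flip: inner_sum_left)
      have "(\<Sum>z\<in>S. G z \<bullet> x) \<le> (\<Sum>z\<in>S. m x + b)" by (rule sum_mono[OF le])
      then have "0 \<le> n * (m x + b)" unfolding sum0 by (simp add: n_def)
      then have nn: "0 \<le> m x + b" using n by (simp add: zero_le_mult_iff)
      \<comment> \<open>For T = m x + b with T \<ge> 0, every number a \<le> T satisfies
        \<bar>a\<bar> \<le> 2T - a. Summing over S cancels the linear terms because the slopes add
        up to 0.\<close>
      have "(\<Sum>z\<in>S. \<bar>G z \<bullet> x\<bar>) \<le> (\<Sum>z\<in>S. 2 * (m x + b) - G z \<bullet> x)"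
        by (rule sum_mono) (use le nn in \<open>fastforce simp: abs_le_iff\<close>)
      also have "\<dots> = n * (2 * (m x + b))" by (simp add: sum_subtractf sum0 n_def)
      finally have "k * norm (P x) \<le> 2 * n * (m x + b)" using k(2)[of x] by (simp add: algebra_simps)
      then show ?thesis using n by (simp add: field_simps)
    qed
    moreover have "k / (2 * n) > 0" using k n by simp
    ultimately show thesis using that by blast
  qed
  define M where "M = (\<lambda>x. m x + (norm (x - P x))\<^sup>2)"
  have lin: "linear (\<lambda>x. x - P x)" using P(1) by (intro linear_compose_sub linear_ident)
  have cvM: "convex_on UNIV M" unfolding M_def
    by (intro convex_on_add cv convex_on_norm_square_linear lin)
  have lowM: "a * norm x - (b + a\<^sup>2) \<le> M x" for x
  proof -
    have "norm x \<le> norm (P x) + norm (x - P x)" using norm_triangle_ineq[of "P x" "x - P x"] by simp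
    then have "a * norm x \<le> a * norm (P x) + a * norm (x - P x)"
      using a by (simp flip: distrib_left)
    moreover have "a * norm (x - P x) \<le> (norm (x - P x))\<^sup>2 + a\<^sup>2"
      using sum_squares_bound[of a "norm (x - P x)"] mult_nonneg_nonneg[OF less_imp_le[OF a] norm_ge_zero[of "x - P x"]]
      by linarith
    ultimately show ?thesis using low[of x] by (simp add: M_def)
  qed
  define C where "C = closure (P ` E)"
  have CX: "C \<subseteq> X" unfolding C_def using P(2) closed_subspace[OF sX] by (intro closure_minimal) auto
  have sdm: "\<exists>g. superdiff m y g" if yC: "y \<in> C" for y
  proof -
    obtain w where w: "\<And>k. w k \<in> P ` E" "w \<longlonglongrightarrow> y"
      using yC unfolding C_def closure_sequential by blast
    then obtain x where x: "\<And>k::nat. x k \<in> E" "\<And>k. w k = P (x k)" unfolding image_iff by metis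
    obtain B where B: "\<And>k. norm (w k) \<le> B"
      using convergent_imp_Bseq[OF convergentI[OF w(2)]] unfolding Bseq_def by blast
    obtain N0 where N0: "\<And>z v. z \<in> E \<Longrightarrow> dist y v \<le> 1 \<Longrightarrow> m v - 1 < c z + G z \<bullet> v \<Longrightarrow> norm (G z) \<le> N0"
      by (rule affine_envelope_slopes_bounded[of m E c G y, OF cont ge]) blast+
    define N where "N = max \<bar>N0\<bar> B"
    \<comment> \<open>A plane nearly active at y is nearly active at w k for late k. Since P changes
      neither m nor the planes, it is then nearly tangent at the data point x k, and
      \<open>close\<close> compares the two slopes.\<close>
    have near: "\<exists>d>0. \<exists>K. \<forall>k\<ge>K. \<forall>z\<in>E. m y - d < c z + G z \<bullet> y \<longrightarrow> norm (G (x k) - G z) \<le> e"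
      if "e > 0" for e
    proof -
      obtain d where d: "d > 0" "\<And>x z. x \<in> E \<Longrightarrow> z \<in> E \<Longrightarrow> norm (P x) \<le> N \<Longrightarrow> norm (G z) \<le> N \<Longrightarrow>
          f x - f z - G z \<bullet> (x - z) < d \<Longrightarrow> norm (G x - G z) \<le> e"
        using close[OF \<open>e > 0\<close>, of N] unfolding P_def by blast
      have "(\<lambda>k. m (w k) + N * norm (w k - y)) \<longlonglongrightarrow> m y + N * norm (y - y)"
        using cont w(2) continuous_on_tendsto_compose[of UNIV m w y] by (intro tendsto_intros) auto
      then have "\<forall>\<^sub>F k in sequentially. m (w k) + N * norm (w k - y) < m y + d / 2"
        using d(1) by (auto dest!: order_tendstoD(2)[where a = "m y + d / 2"])
      then obtain K where K: "\<And>k. k \<ge> K \<Longrightarrow> m (w k) + N * norm (w k - y) < m y + d / 2"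
        unfolding eventually_sequentially by blast
      have "norm (G (x k) - G z) \<le> e"
        if k: "k \<ge> K" and z: "z \<in> E" "m y - min 1 (d / 2) < c z + G z \<bullet> y" for k z
      proof (rule d(2)[OF x(1) z(1)])
        show "norm (P (x k)) \<le> N" using B[of k] by (simp add: x(2) N_def)
        have "norm (G z) \<le> N0" using N0[OF z(1), of y] z(2) by simp
        then show Gz: "norm (G z) \<le> N" by (simp add: N_def)
        have "\<bar>G z \<bullet> (w k - y)\<bar> \<le> norm (G z) * norm (w k - y)" by (rule Cauchy_Schwarz_ineq2)
        also have "\<dots> \<le> N * norm (w k - y)" using Gz by (intro mult_right_mono) auto
        finally have "G z \<bullet> y - G z \<bullet> w k \<le> N * norm (w k - y)" by (simp add: inner_diff_right abs_le_iff)
        moreover have "f (x k) = m (w k)" using mf[OF x(1)[of k]] by (simp add: x(2) mP)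
        moreover have "G z \<bullet> x k = G z \<bullet> w k" using P(4)[OF GX[OF z(1)], of "x k"] by (simp add: x(2))
        ultimately show "f (x k) - f z - G z \<bullet> (x k - z) < d"
          using K[OF k] z(2) by (simp add: c_def inner_diff_right)
      qed
      moreover have "min 1 (d / 2) > 0" using d by simp
      ultimately show ?thesis by blast
    qed
    \<comment> \<open>The slope at y is not given in advance. Any one plane nearly active at y
      serves as a common reference for all late \<open>G (x k)\<close>.\<close>
    have "Cauchy (\<lambda>k. G (x k))"
    proof (rule metric_CauchyI)
      fix e :: real assume "e > 0"
      then have "e / 3 > 0" by simp
      from near[OF this] obtain d K where dK: "d > 0"
        "\<And>k z. k \<ge> K \<Longrightarrow> z \<in> E \<Longrightarrow> m y - d < c z + G z \<bullet> y \<Longrightarrow> norm (G (x k) - G z) \<le> e / 3" by blast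
      obtain z where z: "z \<in> E" "m y - d < c z + G z \<bullet> y" using approx[OF dK(1)] by blast
      have "dist (G (x i)) (G (x j)) < e" if "i \<ge> K" "j \<ge> K" for i j
      proof -
        have "dist (G (x i)) (G z) \<le> e / 3" "dist (G (x j)) (G z) \<le> e / 3"
          using dK(2)[OF _ z] that by (auto simp: dist_norm)
        then show ?thesis using dist_triangle2[of "G (x i)" "G (x j)" "G z"] \<open>e > 0\<close> by linarith
      qed
      then show "\<exists>M. \<forall>i\<ge>M. \<forall>j\<ge>M. dist (G (x i)) (G (x j)) < e" by blast
    qed
    then obtain g where g: "(\<lambda>k. G (x k)) \<longlonglongrightarrow> g" using Cauchy_convergent convergentD by blast
    have "superdiff m y g"
    proof (rule superdiff_affine_envelope[OF cont ge approx])
      fix e :: real assume "e > 0"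
      from near[OF this] obtain d K where dK: "d > 0"
        "\<And>k z. k \<ge> K \<Longrightarrow> z \<in> E \<Longrightarrow> m y - d < c z + G z \<bullet> y \<Longrightarrow> norm (G (x k) - G z) \<le> e" by blast
      have "norm (G z - g) \<le> e" if "z \<in> E" "m y - d < c z + G z \<bullet> y" for z
      proof (rule LIMSEQ_le_const2)
        show "(\<lambda>k. norm (G z - G (x k))) \<longlonglongrightarrow> norm (G z - g)" by (intro tendsto_intros g)
        show "\<exists>K. \<forall>k\<ge>K. norm (G z - G (x k)) \<le> e"
          using dK(2)[OF _ that] by (auto simp: norm_minus_commute)
      qed
      then show "\<exists>d>0. \<forall>z\<in>E. m y - d < c z + G z \<bullet> y \<longrightarrow> norm (G z - g) \<le> e" using dK(1) by blast
    qed
    then show ?thesis by blast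
  qed
  have sdM: "\<exists>g. superdiff M y g" if y: "y \<in> C" for y
  proof -
    have Py: "P y = y" using P(3) CX y by blast
    have "superdiff (\<lambda>x. (norm (x - P x))\<^sup>2) y 0"
    proof (rule superdiff_0_if_quadratic_bound)
      fix h
      have "norm (y + h - P (y + h)) \<le> norm h" using P(6)[of h] by (simp add: linear_add[OF P(1)] Py)
      then show "(norm (y + h - P (y + h)))\<^sup>2 \<le> (norm (y - P y))\<^sup>2 + (norm h)\<^sup>2"
        by (simp add: Py power_mono)
    qed
    then show ?thesis using sdm[OF y] superdiff_add unfolding M_def by blast
  qed
  have Cne: "C \<noteq> {}" using E by (simp add: C_def)
  have Ccl: "closed C" by (simp add: C_def)
  obtain F where F: "convex_on UNIV F" "\<And>x. \<exists>g. superdiff F x g" "\<And>x. M x \<le> F x" "\<And>x. x \<in> C \<Longrightarrow> F x = M x"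
    by (rule coercive_convex_C1_majorant[OF cvM a lowM Ccl Cne sdM]) blast+
  show thesis
  proof (rule that)
    \<comment> \<open>The penalty in M vanishes on X and m is invariant under P, so composition with
      P recovers f even at points of E outside X.\<close>
    show "convex_on UNIV (\<lambda>x. F (P x))"
    proof (rule convex_onI)
      fix t :: real and x y assume "0 < t" "t < 1"
      then show "F (P ((1 - t) *\<^sub>R x + t *\<^sub>R y)) \<le> (1 - t) * F (P x) + t * F (P y)"
        using convex_onD[OF F(1), of t "P x" "P y"] by (simp add: linear_add[OF P(1)] linear_scale[OF P(1)])
    qed auto
    show "\<exists>g. superdiff (\<lambda>x. F (P x)) x g" for x
    proof -
      obtain g where g: "superdiff F (P x) g" using F(2) by blast
      have "superdiff (\<lambda>x. F (P x)) x (P g)"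
        unfolding superdiff_def
      proof (intro allI impI)
        fix e :: real assume e: "e > 0"
        obtain d where d: "d > 0" "\<And>h. norm h < d \<Longrightarrow> F (P x + h) \<le> F (P x) + g \<bullet> h + e * norm h"
          by (rule superdiffD[OF g e]) blast
        show "\<exists>d>0. \<forall>h. norm h < d \<longrightarrow> F (P (x + h)) \<le> F (P x) + P g \<bullet> h + e * norm h"
        proof (intro exI[of _ d] conjI allI impI d(1))
          fix h :: 'a assume "norm h < d"
          then have "F (P (x + h)) \<le> F (P x) + g \<bullet> P h + e * norm (P h)"
            using d(2)[of "P h"] P(5)[of h] by (simp add: linear_add[OF P(1)])
          also have "g \<bullet> P h = P g \<bullet> h"
            using P(4)[OF P(2), of h g] P(4)[OF P(2), of g h] by (simp add: inner_commute)
          also have "e * norm (P h) \<le> e * norm h" using P(5) e by (intro mult_left_mono) auto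
          finally show "F (P (x + h)) \<le> F (P x) + P g \<bullet> h + e * norm h" by simp
        qed
      qed
      then show ?thesis by blast
    qed
    show "F (P x) = f x" if "x \<in> E" for x
    proof -
      have "P x \<in> C" unfolding C_def using imageI[OF that] closure_subset by (rule subsetD[rotated])
      then have "F (P x) = M (P x)" by (rule F(4))
      also have "\<dots> = f x" by (simp add: M_def P(3)[OF P(2)] mP mf[OF that])
      finally show ?thesis .
    qed
    show "f x + G x \<bullet> (y - x) \<le> F (P y)" if "x \<in> E" for x y
    proof -
      have "f x + G x \<bullet> (y - x) = c x + G x \<bullet> y" by (simp add: c_def inner_diff_right)
      also have "\<dots> \<le> m (P y)" using ge[OF that] by (simp add: mP)
      also have "\<dots> \<le> M (P y)" by (simp add: M_def)
      also have "\<dots> \<le> F (P y)" by (rule F(3))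
      finally show ?thesis .
    qed
  qed
qed

lemma superdiff_inner: "superdiff (\<lambda>y. g \<bullet> y) x g"
  unfolding superdiff_def by (auto simp: inner_add_right intro!: exI[of _ 1])

lemma convex_on_inner: "convex_on UNIV (\<lambda>y. g \<bullet> y)"
  by (rule convex_onI) (auto simp: inner_add_right)

lemma convex_C1_extension:
  fixes E :: "'a::euclidean_space set"
  assumes E: "E \<noteq> {}" and X: "X = span {G x - G y | x y. x \<in> E \<and> y \<in> E}"
    and ineq: "\<And>x y. x \<in> E \<Longrightarrow> y \<in> E \<Longrightarrow> f y + G y \<bullet> (x - y) \<le> f x"
    and fin: "\<And>y. \<exists>c. \<forall>z\<in>E. f z + G z \<bullet> (y - z) \<le> c"
    and close: "\<And>N e. e > 0 \<Longrightarrow> \<exists>d>0. \<forall>x\<in>E. \<forall>z\<in>E. norm (orth_proj X x) \<le> N \<longrightarrow> norm (G z) \<le> N \<longrightarrow>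
        f x - f z - G z \<bullet> (x - z) < d \<longrightarrow> norm (G x - G z) \<le> e"
  obtains F where "convex_on UNIV F" "\<And>x. \<exists>g. superdiff F x g" "\<And>x. x \<in> E \<Longrightarrow> F x = f x"
    "\<And>x y. x \<in> E \<Longrightarrow> f x + G x \<bullet> (y - x) \<le> F y"
proof -
  obtain S where S: "finite S" "S \<noteq> {}" "S \<subseteq> E" "span {G x - G y | x y. x \<in> S \<and> y \<in> S} = X"
    unfolding X by (rule finite_spanning_differences[OF E, of G]) blast
  define n where "n = real (card S)"
  have n: "n > 0" using S by (simp add: n_def card_gt_0_iff)
  text \<open>Centering the gradients at their mean over \<^term>\<open>S\<close> makes the sup of the prescribed
    tangent planes coercive on \<^term>\<open>X\<close>.\<close>
  define g0 where "g0 = (\<Sum>z\<in>S. G z) /\<^sub>R n"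
  define G' where "G' = (\<lambda>z. G z - g0)"
  define f' where "f' = (\<lambda>z. f z - g0 \<bullet> z)"
  have sX: "subspace X" by (simp add: X)
  have G'X: "G' z \<in> X" if "z \<in> E" for z
  proof -
    have "G' z = (\<Sum>y\<in>S. G z - G y) /\<^sub>R n"
      using n by (simp add: G'_def g0_def sum_subtractf scaleR_diff_right n_def sum_constant_scaleR)
    moreover have "G z - G y \<in> X" if "y \<in> S" for y
      unfolding X by (rule span_base) (use \<open>z \<in> E\<close> that S in blast)
    ultimately show ?thesis using sX by (simp add: subspace_scale subspace_sum)
  qed
  have S0: "(\<Sum>z\<in>S. G' z) = 0"
    using n by (simp add: G'_def g0_def sum_subtractf n_def sum_constant_scaleR)
  have XS: "X = span (G' ` S)"
  proof (rule antisym)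
    have "{G x - G y | x y. x \<in> S \<and> y \<in> S} \<subseteq> span (G' ` S)"
    proof clarify
      fix x y assume "x \<in> S" "y \<in> S"
      then have "G' x - G' y \<in> span (G' ` S)" by (intro span_diff span_base) auto
      then show "G x - G y \<in> span (G' ` S)" by (simp add: G'_def)
    qed
    then show "X \<subseteq> span (G' ` S)" unfolding S(4)[symmetric] by (intro span_minimal subspace_span)
    show "span (G' ` S) \<subseteq> X" using G'X S(3) by (intro span_minimal sX) auto
  qed
  \<comment> \<open>All tangent planes change by the same linear function of y. Hence gaps and
    differences of slopes are unchanged, and only the bound on the slopes shifts, by
    \<open>norm g0\<close>.\<close>
  have val: "f' z + G' z \<bullet> (y - z) = f z + G z \<bullet> (y - z) - g0 \<bullet> y" for y z
    by (simp add: f'_def G'_def inner_diff_left inner_diff_right)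
  have diff: "G' x - G' z = G x - G z" for x z by (simp add: G'_def)
  have fin': "\<exists>c. \<forall>z\<in>E. f' z + G' z \<bullet> (y - z) \<le> c" for y
  proof -
    obtain c where "\<forall>z\<in>E. f z + G z \<bullet> (y - z) \<le> c" using fin by blast
    then show ?thesis unfolding val by (intro exI[of _ "c - g0 \<bullet> y"]) auto
  qed
  have ineq': "f' y + G' y \<bullet> (x - y) \<le> f' x" if "x \<in> E" "y \<in> E" for x y
    unfolding val using ineq[OF that] by (simp add: f'_def)
  have close': "\<exists>d>0. \<forall>x\<in>E. \<forall>z\<in>E. norm (orth_proj X x) \<le> N \<longrightarrow> norm (G' z) \<le> N \<longrightarrow>
        f' x - f' z - G' z \<bullet> (x - z) < d \<longrightarrow> norm (G' x - G' z) \<le> e" if e: "e > 0" for N e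
  proof -
    obtain d where d: "d > 0" "\<And>x z. x \<in> E \<Longrightarrow> z \<in> E \<Longrightarrow> norm (orth_proj X x) \<le> N + norm g0 \<Longrightarrow> norm (G z) \<le> N + norm g0 \<Longrightarrow>
        f x - f z - G z \<bullet> (x - z) < d \<Longrightarrow> norm (G x - G z) \<le> e"
      using close[OF e, of "N + norm g0"] by blast
    have "norm (G' x - G' z) \<le> e"
      if "x \<in> E" "z \<in> E" "norm (orth_proj X x) \<le> N" "norm (G' z) \<le> N" "f' x - f' z - G' z \<bullet> (x - z) < d" for x z
      unfolding diff
    proof (rule d(2)[OF that(1,2)])
      show "norm (orth_proj X x) \<le> N + norm g0" using that(3) by (simp add: add_increasing2)
      show "norm (G z) \<le> N + norm g0"
        using norm_triangle_ineq[of "G' z" g0] that(4) by (simp add: G'_def)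
      show "f x - f z - G z \<bullet> (x - z) < d" using that(5) val[of z x] by (simp add: f'_def)
    qed
    then show ?thesis using d(1) by blast
  qed
  obtain F where F: "convex_on UNIV F" "\<And>x. \<exists>g. superdiff F x g" "\<And>x. x \<in> E \<Longrightarrow> F x = f' x"
    "\<And>x y. x \<in> E \<Longrightarrow> f' x + G' x \<bullet> (y - x) \<le> F y"
    by (rule convex_C1_extension_centered[OF S(1-3) S0 XS G'X ineq' fin' close']) blast+
  show thesis
  proof (rule that)
    show "convex_on UNIV (\<lambda>x. F x + g0 \<bullet> x)" by (intro convex_on_add F(1) convex_on_inner)
    show "\<exists>g. superdiff (\<lambda>x. F x + g0 \<bullet> x) x g" for x
      using F(2)[of x] superdiff_add[OF _ superdiff_inner] by blast
    show "F x + g0 \<bullet> x = f x" if "x \<in> E" for x using F(3)[OF that] by (simp add: f'_def)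
    show "f x + G x \<bullet> (y - x) \<le> F y + g0 \<bullet> y" if "x \<in> E" for x y
      using F(4)[OF that, of y] unfolding val by simp
  qed
qed

section \<open>Adding finitely many tangent planes to the data\<close>

lemma finite_uniform_gap:
  fixes Q :: "'b \<Rightarrow> real \<Rightarrow> bool"
  assumes "finite J" "\<And>j. j \<in> J \<Longrightarrow> \<exists>d>0. Q j d" "\<And>j d d'. Q j d \<Longrightarrow> d' \<le> d \<Longrightarrow> Q j d'"
  shows "\<exists>d>0. \<forall>j\<in>J. Q j d"
proof -
  obtain d where d: "\<And>j. j \<in> J \<Longrightarrow> d j > 0 \<and> Q j (d j)" using assms(2) by metis
  \<comment> \<open>The inserted 1 covers an empty J.\<close>
  have "Min (insert 1 (d ` J)) > 0" using assms(1) d by simp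
  moreover have "Q j (Min (insert 1 (d ` J)))" if "j \<in> J" for j
    by (rule assms(3)[of j "d j"]) (use assms(1) d that in auto)
  ultimately show ?thesis by blast
qed

text \<open>The points \<open>p j\<close> join E with values \<open>\<beta> j\<close> and gradients
  \<open>w j\<close>. The gaps b, c, d exclude near tangency between a new point and any other
  point, so closeness of gradients on the larger set reduces to closeness on E.\<close>

lemma convex_C1_extension_adding_points:
  fixes E :: "'a::euclidean_space set" and J :: "'b set"
  assumes E: "E \<noteq> {}" and J: "finite J" and pE: "\<And>j. j \<in> J \<Longrightarrow> p j \<notin> E"
    and X: "X = span {u - v | u v. u \<in> G ` E \<union> w ` J \<and> v \<in> G ` E \<union> w ` J}"
    and ineq: "\<And>x y. x \<in> E \<Longrightarrow> y \<in> E \<Longrightarrow> f y + G y \<bullet> (x - y) \<le> f x"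
    and fin: "\<And>y. \<exists>c. \<forall>z\<in>E. f z + G z \<bullet> (y - z) \<le> c"
    and close: "\<And>N e. e > 0 \<Longrightarrow> \<exists>d>0. \<forall>x\<in>E. \<forall>z\<in>E. norm (orth_proj X x) \<le> N \<longrightarrow> norm (G z) \<le> N \<longrightarrow>
        f x - f z - G z \<bullet> (x - z) < d \<longrightarrow> norm (G x - G z) \<le> e"
    and b: "\<And>j. j \<in> J \<Longrightarrow> \<exists>d>0. \<forall>i\<in>J - {j}. \<beta> i + w i \<bullet> (p j - p i) \<le> \<beta> j - d"
    and c: "\<And>j N. j \<in> J \<Longrightarrow> \<exists>d>0. \<forall>z\<in>E. norm (G z) \<le> N \<longrightarrow> f z + G z \<bullet> (p j - z) \<le> \<beta> j - d"
    and d: "\<And>N. \<exists>d>0. \<forall>x\<in>E. norm (orth_proj X x) \<le> N \<longrightarrow> (\<forall>j\<in>J. \<beta> j + w j \<bullet> (x - p j) \<le> f x - d)"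
  obtains F where "convex_on UNIV F" "\<And>x. \<exists>g. superdiff F x g" "\<And>x. x \<in> E \<Longrightarrow> F x = f x"
    "\<And>x y. x \<in> E \<Longrightarrow> f x + G x \<bullet> (y - x) \<le> F y"
proof -
  \<comment> \<open>Coinciding points would make b assert both \<open>\<beta> i < \<beta> j\<close>
    and \<open>\<beta> j < \<beta> i\<close>. Injectivity makes the extended data well
    defined.\<close>
  have inj: "inj_on p J"
  proof (rule inj_onI, rule ccontr)
    fix i j assume ij: "i \<in> J" "j \<in> J" "p i = p j" "i \<noteq> j"
    obtain d1 where "d1 > 0" "\<beta> i + w i \<bullet> (p j - p i) \<le> \<beta> j - d1" using b[OF ij(2)] ij by blast
    moreover obtain d2 where "d2 > 0" "\<beta> j + w j \<bullet> (p i - p j) \<le> \<beta> i - d2" using b[OF ij(1)] ij by blast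
    ultimately show False using ij(3) by simp
  qed
  define f' where "f' = (\<lambda>x. if x \<in> E then f x else \<beta> (the_inv_into J p x))"
  define G' where "G' = (\<lambda>x. if x \<in> E then G x else w (the_inv_into J p x))"
  have onE: "f' x = f x" "G' x = G x" if "x \<in> E" for x using that by (simp_all add: f'_def G'_def)
  have onp: "f' (p j) = \<beta> j" "G' (p j) = w j" if "j \<in> J" for j
    using that pE by (simp_all add: f'_def G'_def the_inv_into_f_f[OF inj])
  define E' where "E' = E \<union> p ` J"
  have "G' ` E' = G ` E \<union> w ` J"
  proof -
    have "G' ` E' = G' ` E \<union> G' ` (p ` J)" unfolding E'_def by (rule image_Un)
    also have "G' ` E = G ` E" by (rule image_cong) (simp_all add: onE)
    also have "G' ` (p ` J) = w ` J" unfolding image_image by (rule image_cong) (simp_all add: onp)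
    finally show ?thesis .
  qed
  then have XE': "X = span {G' x - G' y | x y. x \<in> E' \<and> y \<in> E'}"
    unfolding X by (intro arg_cong[where f = span]) (auto simp flip: \<open>G' ` E' = _\<close>)
  have E'_cases: "(x \<in> E \<Longrightarrow> thesis) \<Longrightarrow> (\<And>j. j \<in> J \<Longrightarrow> x = p j \<Longrightarrow> thesis) \<Longrightarrow> thesis" if "x \<in> E'" for x thesis
    using that by (auto simp: E'_def)
  have ineq': "f' y + G' y \<bullet> (x - y) \<le> f' x" if "x \<in> E'" "y \<in> E'" for x y
  proof (rule E'_cases[OF that(1)]; rule E'_cases[OF that(2)])
    assume "x \<in> E" "y \<in> E"
    then show ?thesis using ineq by (simp add: onE)
  next
    fix j assume "x \<in> E" "j \<in> J" "y = p j"
    then show ?thesis using d[of "norm (orth_proj X x)"] by (fastforce simp: onE onp)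
  next
    fix j assume "y \<in> E" "j \<in> J" "x = p j"
    then show ?thesis using c[of j "norm (G y)"] by (fastforce simp: onE onp)
  next
    fix i j assume *: "j \<in> J" "x = p j" "i \<in> J" "y = p i"
    show ?thesis
    proof (cases "i = j")
      case False
      then obtain d where "d > 0" "\<beta> i + w i \<bullet> (p j - p i) \<le> \<beta> j - d" using b[OF *(1)] *(3) by blast
      then show ?thesis using * by (simp add: onp)
    qed (use * in \<open>simp add: onp\<close>)
  qed
  have fin': "\<exists>c. \<forall>z\<in>E'. f' z + G' z \<bullet> (y - z) \<le> c" for y
  proof -
    obtain c where c: "\<And>z. z \<in> E \<Longrightarrow> f z + G z \<bullet> (y - z) \<le> c" using fin by blast
    define s where "s = (\<Sum>j\<in>J. \<bar>\<beta> j + w j \<bullet> (y - p j)\<bar>)"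
    have s: "s \<ge> 0" unfolding s_def by (intro sum_nonneg) auto
    have "f' z + G' z \<bullet> (y - z) \<le> \<bar>c\<bar> + s" if "z \<in> E'" for z
    proof (rule E'_cases[OF that])
      assume "z \<in> E"
      then show ?thesis using c[of z] s by (simp add: onE)
    next
      fix j assume j: "j \<in> J" "z = p j"
      have "\<bar>\<beta> j + w j \<bullet> (y - p j)\<bar> \<le> s" unfolding s_def using J j by (intro member_le_sum) auto
      then show ?thesis using j by (simp add: onp)
    qed
    then show ?thesis by blast
  qed
  have close': "\<exists>d>0. \<forall>x\<in>E'. \<forall>z\<in>E'. norm (orth_proj X x) \<le> N \<longrightarrow> norm (G' z) \<le> N \<longrightarrow>
        f' x - f' z - G' z \<bullet> (x - z) < d \<longrightarrow> norm (G' x - G' z) \<le> e" if e: "e > 0" for N e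
  proof -
    obtain da where da: "da > 0" "\<And>x z. x \<in> E \<Longrightarrow> z \<in> E \<Longrightarrow> norm (orth_proj X x) \<le> N \<Longrightarrow> norm (G z) \<le> N \<Longrightarrow>
        f x - f z - G z \<bullet> (x - z) < da \<Longrightarrow> norm (G x - G z) \<le> e"
      using close[OF e, of N] by blast
    have "\<exists>d>0. \<forall>j\<in>J. \<forall>i\<in>J - {j}. \<beta> i + w i \<bullet> (p j - p i) \<le> \<beta> j - d"
      by (rule finite_uniform_gap[OF J b]) force+
    then obtain db where db: "db > 0" "\<And>i j. j \<in> J \<Longrightarrow> i \<in> J - {j} \<Longrightarrow> \<beta> i + w i \<bullet> (p j - p i) \<le> \<beta> j - db" by blast
    have "\<exists>d>0. \<forall>j\<in>J. \<forall>z\<in>E. norm (G z) \<le> N \<longrightarrow> f z + G z \<bullet> (p j - z) \<le> \<beta> j - d"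
      by (rule finite_uniform_gap[OF J c]) force+
    then obtain dc where dc: "dc > 0" "\<And>z j. j \<in> J \<Longrightarrow> z \<in> E \<Longrightarrow> norm (G z) \<le> N \<Longrightarrow> f z + G z \<bullet> (p j - z) \<le> \<beta> j - dc" by blast
    obtain dd where dd: "dd > 0" "\<And>x j. x \<in> E \<Longrightarrow> norm (orth_proj X x) \<le> N \<Longrightarrow> j \<in> J \<Longrightarrow> \<beta> j + w j \<bullet> (x - p j) \<le> f x - dd"
      using d[of N] by blast
    define dm where "dm = Min {da, db, dc, dd}"
    have dm: "dm > 0" "dm \<le> da" "dm \<le> db" "dm \<le> dc" "dm \<le> dd" using da(1) db(1) dc(1) dd(1) by (auto simp: dm_def)
    have "norm (G' x - G' z) \<le> e"
      if xz: "x \<in> E'" "z \<in> E'" and N: "norm (orth_proj X x) \<le> N" "norm (G' z) \<le> N"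
        and lt: "f' x - f' z - G' z \<bullet> (x - z) < dm" for x z
    proof (rule E'_cases[OF xz(1)]; rule E'_cases[OF xz(2)])
      assume "x \<in> E" "z \<in> E"
      then show ?thesis using da(2)[of x z] N lt dm by (simp add: onE)
    next
      fix j assume "x \<in> E" "j \<in> J" "z = p j"
      then show ?thesis using dd(2)[of x j] N lt dm by (simp add: onE onp)
    next
      fix j assume "z \<in> E" "j \<in> J" "x = p j"
      then show ?thesis using dc(2)[of j z] N lt dm by (simp add: onE onp)
    next
      fix i j assume *: "j \<in> J" "x = p j" "i \<in> J" "z = p i"
      show ?thesis
      proof (cases "i = j")
        case False
        then show ?thesis using db(2)[of j i] * lt dm by (simp add: onp)
      qed (use * e in simp)
    qed
    then show ?thesis using dm(1) by blast
  qed
  have "E' \<noteq> {}" using E by (simp add: E'_def)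
  obtain F where F: "convex_on UNIV F" "\<And>x. \<exists>g. superdiff F x g" "\<And>x. x \<in> E' \<Longrightarrow> F x = f' x"
    "\<And>x y. x \<in> E' \<Longrightarrow> f' x + G' x \<bullet> (y - x) \<le> F y"
    by (rule convex_C1_extension[OF \<open>E' \<noteq> {}\<close> XE' ineq' fin' close']) blast+
  show thesis
  proof (rule that[OF F(1,2)])
    show "F x = f x" "f x + G x \<bullet> (y - x) \<le> F y" if "x \<in> E" for x y
      using F(3)[of x] F(4)[of x y] that by (simp_all add: E'_def onE)
  qed
qed

text \<open>Planes with values at y tending to infinity still lie below \<open>f x\<close> at a
  fixed x in E, so their slopes must blow up. Then (ii) makes their offset outweigh
  \<open>G z \<bullet> y\<close>, and eventually their value at y is at most 0.\<close>

lemma tangent_planes_bounded: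
  fixes E :: "'a::euclidean_space set"
  assumes E: "E \<noteq> {}" and ineq: "\<And>x y. x \<in> E \<Longrightarrow> y \<in> E \<Longrightarrow> f y + G y \<bullet> (x - y) \<le> f x"
    and ii: "\<And>x. range x \<subseteq> E \<Longrightarrow> filterlim (\<lambda>k. norm (G (x k))) at_top sequentially \<Longrightarrow>
        filterlim (\<lambda>k. (G (x k) \<bullet> x k - f (x k)) / norm (G (x k))) at_top sequentially"
  shows "\<exists>c. \<forall>z\<in>E. f z + G z \<bullet> (y - z) \<le> c"
proof (rule ccontr)
  assume "\<not> ?thesis"
  then have "\<forall>k. \<exists>z\<in>E. f z + G z \<bullet> (y - z) > real k" by (metis not_le)
  then obtain z where z: "\<And>k::nat. z k \<in> E" "\<And>k. f (z k) + G (z k) \<bullet> (y - z k) > real k" by metis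
  obtain x where x: "x \<in> E" using E by blast
  have norm_ge: "real k - f x \<le> (norm (y - x) + 1) * norm (G (z k))" for k
  proof -
    have "real k \<le> f x + G (z k) \<bullet> (y - x)"
      using z(2)[of k] ineq[OF x z(1), of k] by (simp add: inner_diff_right)
    also have "G (z k) \<bullet> (y - x) \<le> norm (G (z k)) * norm (y - x)" by (rule norm_cauchy_schwarz)
    also have "\<dots> \<le> (norm (y - x) + 1) * norm (G (z k))" by (simp add: algebra_simps)
    finally show ?thesis by simp
  qed
  have "filterlim (\<lambda>k. norm (G (z k))) at_top sequentially"
  proof (rule filterlim_at_top_mono)
    have pos: "norm (y - x) + 1 > 0" by (simp add: add_nonneg_pos)
    then show "\<forall>\<^sub>F k in sequentially. (real k - f x) / (norm (y - x) + 1) \<le> norm (G (z k))"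
      using norm_ge by (simp add: pos_divide_le_eq mult.commute)
    have "filterlim (\<lambda>k. - f x + real k) at_top sequentially"
      by (intro filterlim_tendsto_add_at_top[OF tendsto_const] filterlim_real_sequentially)
    then have "filterlim (\<lambda>k. (1 / (norm (y - x) + 1)) * (- f x + real k)) at_top sequentially"
      using pos by (intro filterlim_tendsto_pos_mult_at_top[OF tendsto_const]) auto
    then show "filterlim (\<lambda>k. (real k - f x) / (norm (y - x) + 1)) at_top sequentially"
      by (simp add: add.commute)
  qed
  note lim = this
  have "range z \<subseteq> E" using z(1) by blast
  \<comment> \<open>The threshold \<open>norm y\<close> is the Cauchy-Schwarz bound for
    \<open>G (z k) \<bullet> y\<close> divided by the norm of the slope.\<close>
  from ii[OF this lim] have "\<forall>\<^sub>F k in sequentially. norm y \<le> (G (z k) \<bullet> z k - f (z k)) / norm (G (z k))"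
    unfolding filterlim_at_top by blast
  moreover have "\<forall>\<^sub>F k in sequentially. 1 \<le> norm (G (z k))" using lim unfolding filterlim_at_top by blast
  ultimately have "\<forall>\<^sub>F k in sequentially. norm y \<le> (G (z k) \<bullet> z k - f (z k)) / norm (G (z k)) \<and> 1 \<le> norm (G (z k))"
    by (rule eventually_conj)
  then obtain k where k: "norm y \<le> (G (z k) \<bullet> z k - f (z k)) / norm (G (z k))" "1 \<le> norm (G (z k))"
    using eventually_happens'[OF sequentially_bot] by blast
  have pos: "norm (G (z k)) > 0" using k(2) by linarith
  have "norm (G (z k)) * norm y \<le> G (z k) \<bullet> z k - f (z k)"
    using k(1) unfolding pos_le_divide_eq[OF pos] by (simp add: mult.commute)
  then have "G (z k) \<bullet> y - (G (z k) \<bullet> z k - f (z k)) \<le> 0"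
    using norm_cauchy_schwarz[of "G (z k)" y] by linarith
  then show False using z(2)[of k] by (simp add: inner_diff_right)
qed

section \<open>Gradients of convex functions\<close>

text \<open>The vector x - P x is orthogonal to all differences of gradients, so every gradient has
  the same product with it. The tangent inequalities at both ends of the segment then hold with
  equality.\<close>

lemma convex_gradient_along_complement:
  fixes F :: "'a::euclidean_space \<Rightarrow> real"
  assumes cv: "convex_on UNIV F" and gd: "\<And>x. GDERIV F x :> g x"
    and X: "subspace X" and gX: "\<And>x y. g x - g y \<in> X"
  shows "F x - F (orth_proj X x) = g z \<bullet> (x - orth_proj X x)"
proof -
  define p where "p = orth_proj X x"
  have same: "g a \<bullet> (x - p) = g z \<bullet> (x - p)" for a
  proof -
    have "(x - p) \<bullet> (g a - g z) = 0" using orth_proj(2)[OF X, of x] gX by (simp add: p_def)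
    then show ?thesis by (simp add: inner_diff_right inner_commute)
  qed
  have "F p + g p \<bullet> (x - p) \<le> F x" "F x + g x \<bullet> (p - x) \<le> F p"
    by (rule convex_GDERIV_ge[OF cv gd])+
  moreover have "g x \<bullet> (p - x) = - (g x \<bullet> (x - p))" by (simp add: inner_diff_right)
  ultimately have "F x - F p = g z \<bullet> (x - p)" using same[of p] same[of x] by linarith
  then show ?thesis by (simp add: p_def)
qed

lemma gradients_close_if_nearly_tangent:
  fixes F :: "'a::euclidean_space \<Rightarrow> real"
  assumes cv: "convex_on UNIV F" and gd: "\<And>x. GDERIV F x :> g x"
    and X: "subspace X" and gX: "\<And>x y. g x - g y \<in> X" and e: "e > 0"
  shows "\<exists>d>0. \<forall>x z. norm (orth_proj X x) \<le> N \<longrightarrow> F x - F z - g z \<bullet> (x - z) < d \<longrightarrow> norm (g x - g z) \<le> e"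
proof (rule ccontr)
  define P where "P = orth_proj X"
  define D where "D = (\<lambda>x z. F x - F z - g z \<bullet> (x - z))"
  have DP: "D (P x) z = D x z" for x z
    using convex_gradient_along_complement[OF cv gd X gX, of x z] by (simp add: D_def P_def inner_diff_right)
  have D0: "D x z \<ge> 0" for x z using convex_GDERIV_ge[OF cv gd, of z x] by (simp add: D_def)
  assume "\<not> ?thesis"
  then have "\<exists>x z. norm (P x) \<le> N \<and> D x z < d \<and> norm (g x - g z) > e" if "d > 0" for d
    using that unfolding P_def D_def not_le[symmetric] by blast
  then have "\<exists>x z. norm (P x) \<le> N \<and> D x z < 1 / real (Suc k) \<and> norm (g x - g z) > e" for k by simp
  then obtain x z where xz: "\<And>k. norm (P (x k)) \<le> N" "\<And>k. D (x k) (z k) < 1 / real (Suc k)"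
    "\<And>k. norm (g (x k) - g (z k)) > e" by metis
  have inN: "\<forall>k. P (x k) \<in> cball 0 N" using xz(1) by simp
  have "seq_compact (cball (0::'a) N)" by (simp flip: compact_eq_seq_compact_metric)
  then obtain q and r :: "nat \<Rightarrow> nat" where r: "strict_mono r" "((\<lambda>k. P (x k)) \<circ> r) \<longlonglongrightarrow> q"
    using inN by (rule seq_compactE) blast
  then have lim: "(\<lambda>k. P (x (r k))) \<longlonglongrightarrow> q" by (simp add: comp_def)
  \<comment> \<open>The plane at b misses \<open>F (P a)\<close> by exactly \<open>D a b\<close>, so
    \<open>g b\<close> is an approximate subgradient at P a with that error. For b = a the error is
    0.\<close>
  have sub: "F y \<ge> F (P a) - D a b + g b \<bullet> (y - P a)" for y a b
    using convex_GDERIV_ge[OF cv gd, of b y] DP[of a b] by (simp add: D_def inner_diff_right)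
  have inv0: "(\<lambda>k. 1 / real (Suc (r k))) \<longlonglongrightarrow> 0"
    using LIMSEQ_subseq_LIMSEQ[OF LIMSEQ_inverse_real_of_nat r(1)] by (simp add: comp_def inverse_eq_divide)
  have "(\<lambda>k. g (z (r k))) \<longlonglongrightarrow> g q"
  proof (rule approximate_subgradients_tendsto[OF cv gd lim inv0])
    show "F y \<ge> F (P (x (r k))) - 1 / real (Suc (r k)) + g (z (r k)) \<bullet> (y - P (x (r k)))" for k y
      using sub[of "x (r k)" "z (r k)" y] xz(2)[of "r k"] by linarith
  qed simp
  moreover have "(\<lambda>k. g (x (r k))) \<longlonglongrightarrow> g q"
  proof (rule approximate_subgradients_tendsto[OF cv gd lim tendsto_const])
    show "F y \<ge> F (P (x (r k))) - 0 + g (x (r k)) \<bullet> (y - P (x (r k)))" for k y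
      using sub[of "x (r k)" "x (r k)" y] by (simp add: D_def)
  qed simp
  ultimately have "(\<lambda>k. norm (g (x (r k)) - g (z (r k)))) \<longlonglongrightarrow> norm (g q - g q)" by (intro tendsto_intros)
  then have "norm (g q - g q) \<ge> e" by (rule LIMSEQ_le_const) (use xz(3) less_imp_le in blast)
  then show False using e by simp
qed

text \<open>The numerator is the value of the convex conjugate of F at \<open>G (x k)\<close>.
  Testing it on the sphere of radius s, where F is bounded, gives growth with rate at least s up to
  a constant.\<close>

lemma convex_conjugate_superlinear:
  fixes F :: "'a::euclidean_space \<Rightarrow> real"
  assumes cv: "convex_on UNIV F" and sub: "\<And>k y. F (x k) + G (x k) \<bullet> (y - x k) \<le> F y"
    and lim: "filterlim (\<lambda>k. norm (G (x k))) at_top sequentially"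
  shows "filterlim (\<lambda>k. (G (x k) \<bullet> x k - F (x k)) / norm (G (x k))) at_top sequentially"
  unfolding filterlim_at_top
proof
  fix R :: real
  \<comment> \<open>The extra unit of radius absorbs the constant M as soon as the slope has norm at
    least \<bar>M\<bar>.\<close>
  define s where "s = \<bar>R\<bar> + 1"
  have "bounded (F ` cball 0 s)"
    by (intro compact_imp_bounded compact_continuous_image
        continuous_on_subset[OF convex_on_continuous[OF open_UNIV cv]]) auto
  then obtain M where M: "\<And>y. norm y \<le> s \<Longrightarrow> F y \<le> M" unfolding bounded_iff by (force simp: abs_le_iff)
  have "\<forall>\<^sub>F k in sequentially. \<bar>M\<bar> + 1 \<le> norm (G (x k))" using lim unfolding filterlim_at_top by blast
  then show "\<forall>\<^sub>F k in sequentially. R \<le> (G (x k) \<bullet> x k - F (x k)) / norm (G (x k))"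
  proof eventually_elim
    case (elim k)
    define v where "v = G (x k)"
    have v: "norm v > 0" "\<bar>M\<bar> \<le> norm v" using elim by (auto simp: v_def)
    have "v \<bullet> (s *\<^sub>R sgn v) = s * norm v"
      using v(1) by (simp add: sgn_div_norm power2_norm_eq_inner[symmetric] power2_eq_square)
    moreover have "F (s *\<^sub>R sgn v) \<le> M" using M[of "s *\<^sub>R sgn v"] by (simp add: s_def norm_sgn)
    moreover have "F (x k) + (v \<bullet> (s *\<^sub>R sgn v) - v \<bullet> x k) \<le> F (s *\<^sub>R sgn v)"
      using sub[of k "s *\<^sub>R sgn v"] by (simp only: v_def inner_diff_right)
    ultimately have "s * norm v - M \<le> v \<bullet> x k - F (x k)" by linarith
    moreover have "s * norm v - M \<ge> \<bar>R\<bar> * norm v" using v by (simp add: s_def algebra_simps abs_le_iff)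
    moreover have "R * norm v \<le> \<bar>R\<bar> * norm v" by (intro mult_right_mono) auto
    ultimately have "R * norm v \<le> v \<bullet> x k - F (x k)" by linarith
    then show ?case using v(1) unfolding v_def by (simp add: pos_le_divide_eq)
  qed
qed

text \<open>A basis of Y is extended by differences taken from the common base point x0, so each new
  basis vector belongs to one point \<open>p j\<close>. Independence keeps it out of the span of Y
  and the others, which later separates the gradients.\<close>

lemma exists_points_completing_span:
  fixes g :: "'b \<Rightarrow> 'a::euclidean_space"
  assumes Y: "subspace Y" "Y \<subseteq> X" and X: "X = span {g x - g y | x y. True}"
  obtains p where "\<And>j. j \<in> {1..dim X - dim Y} \<Longrightarrow> g (p j) - g x0 \<notin> span (Y \<union> (\<lambda>i. g (p i) - g x0) ` ({1..dim X - dim Y} - {j}))"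
    "X = span (Y \<union> (\<lambda>j. g (p j) - g x0) ` {1..dim X - dim Y})"
proof -
  define V where "V = {g x - g x0 | x. True}"
  have VX: "V \<subseteq> X" unfolding X V_def by (auto intro!: span_base)
  obtain A where A: "A \<subseteq> Y" "independent A" "Y \<subseteq> span A" "card A = dim Y" using basis_exists by blast
  obtain B where B: "A \<subseteq> B" "B \<subseteq> A \<union> V" "independent B" "A \<union> V \<subseteq> span B"
    using maximal_independent_subset_extend[of A "A \<union> V"] A(2) by blast
  have BX: "B \<subseteq> X" using B(2) A(1) Y(2) VX by blast
  have "X \<subseteq> span B"
    unfolding X
  proof (intro span_minimal subspace_span subsetI)
    fix v assume "v \<in> {g x - g y | x y. True}"
    then obtain x y where "v = (g x - g x0) - (g y - g x0)" by auto
    moreover have "g x - g x0 \<in> span B" "g y - g x0 \<in> span B" using B(4) by (auto simp: V_def)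
    ultimately show "v \<in> span B" by (simp only: span_diff)
  qed
  moreover have "span B \<subseteq> X" unfolding X by (intro span_minimal subspace_span) (use BX in \<open>simp add: X\<close>)
  ultimately have spB: "span B = X" by blast
  have finB: "finite B" using B(3) by (rule independent_imp_finite)
  have cardB: "card B = dim X" using dim_eq_card[of B X] B(3) spB by (metis span_span)
  have "card (B - A) = dim X - dim Y" using card_Diff_subset[OF finite_subset[OF B(1) finB] B(1)] cardB A(4) by simp
  then obtain b where b: "bij_betw b {1..dim X - dim Y} (B - A)"
    using ex_bij_betw_nat_finite_1[of "B - A"] finB by auto
  have "\<exists>x. b j = g x - g x0" if "j \<in> {1..dim X - dim Y}" for j
  proof -
    have "b j \<in> V" using bij_betwE[OF b] that B(2) by blast
    then show ?thesis by (auto simp: V_def)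
  qed
  then obtain p where p: "\<And>j. j \<in> {1..dim X - dim Y} \<Longrightarrow> b j = g (p j) - g x0" by metis
  have img: "(\<lambda>i. g (p i) - g x0) ` I = b ` I" if "I \<subseteq> {1..dim X - dim Y}" for I
    using p that by (intro image_cong) auto
  have YA: "span A = Y" using A(1,3) Y(1) by (intro antisym span_minimal)
  show thesis
  proof (rule that)
    fix j assume j: "j \<in> {1..dim X - dim Y}"
    have bj: "b j \<in> B" "b j \<notin> A" using bij_betwE[OF b] j by auto
    have "b ` ({1..dim X - dim Y} - {j}) \<subseteq> B - {b j}"
      using b j unfolding bij_betw_def inj_on_def by fastforce
    moreover have "Y \<subseteq> span (B - {b j})" unfolding YA[symmetric] using B(1) bj by (intro span_mono) blast
    ultimately have "span (Y \<union> b ` ({1..dim X - dim Y} - {j})) \<subseteq> span (B - {b j})"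
      by (intro span_minimal subspace_span Un_least) (auto intro: span_base)
    moreover have "b j \<notin> span (B - {b j})" using B(3) bj(1) unfolding dependent_def by blast
    ultimately have "b j \<notin> span (Y \<union> b ` ({1..dim X - dim Y} - {j}))" by blast
    then show "g (p j) - g x0 \<notin> span (Y \<union> (\<lambda>i. g (p i) - g x0) ` ({1..dim X - dim Y} - {j}))"
      by (simp add: img p[OF j])
  next
    have "b ` {1..dim X - dim Y} = B - A" using b by (simp add: bij_betw_def)
    then have "span (Y \<union> b ` {1..dim X - dim Y}) = span (A \<union> (B - A))"
      unfolding YA[symmetric] by (simp only: span_Un span_span)
    also have "\<dots> = X" using B(1) spB by (simp add: Un_absorb1)
    finally show "X = span (Y \<union> (\<lambda>j. g (p j) - g x0) ` {1..dim X - dim Y})" by (simp add: img)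
  qed
qed

text \<open>A strict inequality for a supremum is a gap uniform over the index set. For an empty
  index set the supremum is -\<infinity> and both sides hold.\<close>

lemma SUP_ereal_less_iff:
  "(SUP z\<in>A. ereal (h z)) < ereal b \<longleftrightarrow> (\<exists>d>0. \<forall>z\<in>A. h z \<le> b - d)"
proof
  assume "(SUP z\<in>A. ereal (h z)) < ereal b"
  then obtain c where c: "(SUP z\<in>A. ereal (h z)) < ereal c" "ereal c < ereal b" using ereal_dense2 by blast
  have "h z \<le> c" if "z \<in> A" for z
  proof -
    have "ereal (h z) < ereal c" using SUP_upper[OF that] c(1) by (rule le_less_trans)
    then show ?thesis by simp
  qed
  then show "\<exists>d>0. \<forall>z\<in>A. h z \<le> b - d" using c(2) by (intro exI[of _ "b - c"]) auto
next
  assume "\<exists>d>0. \<forall>z\<in>A. h z \<le> b - d"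
  then obtain d where d: "d > 0" "\<forall>z\<in>A. h z \<le> b - d" by blast
  then have "(SUP z\<in>A. ereal (h z)) \<le> ereal (b - d)" by (intro SUP_least) auto
  also have "\<dots> < ereal b" using d by simp
  finally show "(SUP z\<in>A. ereal (h z)) < ereal b" .
qed

lemma INF_ereal_greater_iff:
  "0 < (INF z\<in>A. ereal (h z)) \<longleftrightarrow> (\<exists>d>0. \<forall>z\<in>A. d \<le> h z)"
proof
  assume "0 < (INF z\<in>A. ereal (h z))"
  then obtain c where c: "0 < ereal c" "ereal c < (INF z\<in>A. ereal (h z))" using ereal_dense2 by blast
  have "c \<le> h z" if "z \<in> A" for z
  proof -
    have "ereal c < ereal (h z)" using c(2) INF_lower[OF that] by (rule less_le_trans)
    then show ?thesis by simp
  qed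
  then show "\<exists>d>0. \<forall>z\<in>A. d \<le> h z" using c(1) by auto
next
  assume "\<exists>d>0. \<forall>z\<in>A. d \<le> h z"
  then obtain d where d: "d > 0" "\<forall>z\<in>A. d \<le> h z" by blast
  have "0 < ereal d" using d by simp
  also have "\<dots> \<le> (INF z\<in>A. ereal (h z))" using d by (intro INF_greatest) auto
  finally show "0 < (INF z\<in>A. ereal (h z))" .
qed

text \<open>Condition (iv) in epsilon-delta form. By \<open>ineq\<close> the gaps are nonnegative,
  so counterexamples with gap below 1 / (k + 1) form sequences to which (iv) applies.\<close>

lemma gradients_close_of_sequences:
  fixes E :: "'a::euclidean_space set"
  assumes ineq: "\<And>x y. x \<in> E \<Longrightarrow> y \<in> E \<Longrightarrow> f y + G y \<bullet> (x - y) \<le> f x"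
    and iv: "\<And>x z. range x \<subseteq> E \<Longrightarrow> range z \<subseteq> E \<Longrightarrow> bounded (range (\<lambda>k. orth_proj X (x k))) \<Longrightarrow>
        bounded (range (\<lambda>k. G (z k))) \<Longrightarrow> (\<lambda>k. f (x k) - f (z k) - G (z k) \<bullet> (x k - z k)) \<longlonglongrightarrow> 0 \<Longrightarrow>
        (\<lambda>k. norm (G (x k) - G (z k))) \<longlonglongrightarrow> 0"
    and e: "e > 0"
  shows "\<exists>d>0. \<forall>x\<in>E. \<forall>z\<in>E. norm (orth_proj X x) \<le> N \<longrightarrow> norm (G z) \<le> N \<longrightarrow>
        f x - f z - G z \<bullet> (x - z) < d \<longrightarrow> norm (G x - G z) \<le> e"
proof (rule ccontr)
  define D where "D = (\<lambda>x z. f x - f z - G z \<bullet> (x - z))"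
  assume "\<not> ?thesis"
  then have "\<exists>x z. x \<in> E \<and> z \<in> E \<and> norm (orth_proj X x) \<le> N \<and> norm (G z) \<le> N \<and> D x z < d \<and> norm (G x - G z) > e"
    if "d > 0" for d
    using that unfolding D_def not_le[symmetric] by blast
  then have "\<exists>x z. x \<in> E \<and> z \<in> E \<and> norm (orth_proj X x) \<le> N \<and> norm (G z) \<le> N \<and> D x z < 1 / real (Suc k) \<and> norm (G x - G z) > e"
    for k by simp
  then obtain x z where xz: "\<And>k. x k \<in> E" "\<And>k. z k \<in> E" "\<And>k. norm (orth_proj X (x k)) \<le> N" "\<And>k. norm (G (z k)) \<le> N"
    "\<And>k. D (x k) (z k) < 1 / real (Suc k)" "\<And>k. norm (G (x k) - G (z k)) > e" by metis
  have "(\<lambda>k. D (x k) (z k)) \<longlonglongrightarrow> 0"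
  proof (rule tendsto_sandwich[OF _ _ tendsto_const])
    show "\<forall>\<^sub>F k in sequentially. 0 \<le> D (x k) (z k)"
      using ineq[OF xz(1,2)] by (simp add: D_def algebra_simps)
    show "\<forall>\<^sub>F k in sequentially. D (x k) (z k) \<le> 1 / real (Suc k)"
      by (intro always_eventually allI less_imp_le xz(5))
    show "(\<lambda>k. 1 / real (Suc k)) \<longlonglongrightarrow> 0" using LIMSEQ_inverse_real_of_nat by (simp add: inverse_eq_divide)
  qed
  then have "(\<lambda>k. norm (G (x k) - G (z k))) \<longlonglongrightarrow> 0"
    unfolding D_def by (intro iv) (use xz(1-4) in \<open>auto simp: bounded_iff\<close>)
  then have "e \<le> 0" by (rule LIMSEQ_le_const) (use xz(6) less_imp_le in blast)
  then show False using e by simp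
qed

lemma C1_convex_separating_points:
  fixes F :: "'a::euclidean_space \<Rightarrow> real"
  assumes cv: "convex_on UNIV F" and gd: "\<And>x. GDERIV F x :> g x" and g: "continuous_on UNIV g" and E: "E \<noteq> {}"
    and X: "X = span {g x - g y | x y. True}" and Y: "Y = span {g x - g y | x y. x \<in> E \<and> y \<in> E}"
    and J: "J = {1..dim X - dim Y}"
  obtains p :: "nat \<Rightarrow> 'a" where "\<And>j. j \<in> J \<Longrightarrow> p j \<notin> closure E"
    "X = span {u - v | u v. u \<in> g ` E \<union> (\<lambda>j. g (p j)) ` J \<and> v \<in> g ` E \<union> (\<lambda>j. g (p j)) ` J}"
    "\<And>j. j \<in> J \<Longrightarrow> \<exists>d>0. \<forall>i\<in>J - {j}. F (p i) + g (p i) \<bullet> (p j - p i) \<le> F (p j) - d"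
    "\<And>j. j \<in> J \<Longrightarrow> \<exists>d>0. \<forall>z\<in>E. F z + g z \<bullet> (p j - z) \<le> F (p j) - d"
    "\<And>N j. j \<in> J \<Longrightarrow> \<exists>d>0. \<forall>x\<in>E. norm (orth_proj X x) \<le> N \<longrightarrow> F (p j) + g (p j) \<bullet> (x - p j) \<le> F x - d"
proof -
  have sX: "subspace X" and sY: "subspace Y" by (simp_all add: X Y)
  have gX: "g x - g y \<in> X" for x y unfolding X by (rule span_base) blast
  have gY: "g x - g y \<in> Y" if "x \<in> E" "y \<in> E" for x y unfolding Y by (rule span_base) (use that in blast)
  have YX: "Y \<subseteq> X" unfolding X Y by (intro span_mono) blast
  obtain x0 where x0: "x0 \<in> E" using E by blast
  obtain p :: "nat \<Rightarrow> 'a" where p: "\<And>j. j \<in> J \<Longrightarrow> g (p j) - g x0 \<notin> span (Y \<union> (\<lambda>i. g (p i) - g x0) ` (J - {j}))"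
    "X = span (Y \<union> (\<lambda>j. g (p j) - g x0) ` J)"
  proof (rule exists_points_completing_span[OF sY YX X, of x0, folded J])
    fix p :: "nat \<Rightarrow> 'a"
    assume "\<And>j. j \<in> J \<Longrightarrow> g (p j) - g x0 \<notin> span (Y \<union> (\<lambda>i. g (p i) - g x0) ` (J - {j}))"
      "X = span (Y \<union> (\<lambda>j. g (p j) - g x0) ` J)"
    then show thesis by (rule that)
  qed
  have sep: "\<exists>e>0. (\<forall>z\<in>E. e \<le> norm (g (p j) - g z)) \<and> (\<forall>i\<in>J - {j}. e \<le> norm (g (p j) - g (p i)))"
    if j: "j \<in> J" for j
  proof -
    \<comment> \<open>T contains \<open>g z - g x0\<close> for every z in E and for every other new
      point. A subspace together with a finite set is closed, so the vector of \<open>p j\<close>,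
      lying outside, has positive distance from T.\<close>
    define T where "T = Y \<union> (\<lambda>i. g (p i) - g x0) ` (J - {j})"
    have "closed T" unfolding T_def
      by (intro closed_Un closed_subspace sY finite_imp_closed finite_imageI) (simp add: J)
    moreover have "g (p j) - g x0 \<notin> T"
    proof
      assume "g (p j) - g x0 \<in> T"
      then have "g (p j) - g x0 \<in> span T" by (rule span_base)
      then show False using p(1)[OF j] by (simp add: T_def)
    qed
    ultimately obtain e where e: "e > 0" "\<And>v. v \<in> T \<Longrightarrow> e \<le> dist (g (p j) - g x0) v"
      using separate_point_closed by metis
    have "e \<le> norm (g (p j) - g z)" if "g z - g x0 \<in> T" for z
      using e(2)[OF that] by (simp add: dist_norm)
    moreover have "g z - g x0 \<in> T" if "z \<in> E" for z using gY[OF that x0] by (simp add: T_def)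
    moreover have "g (p i) - g x0 \<in> T" if "i \<in> J - {j}" for i using that by (auto simp: T_def)
    ultimately show ?thesis using e(1) by blast
  qed
  \<comment> \<open>Used contrapositively: gradients at distance at least e exceed e / 2, so the gap
    is at least a fixed d.\<close>
  have close: "\<exists>d>0. \<forall>x z. norm (orth_proj X x) \<le> N \<longrightarrow> F x - F z - g z \<bullet> (x - z) < d \<longrightarrow> norm (g x - g z) \<le> e / 2"
    if "e > 0" for N e
    using gradients_close_if_nearly_tangent[OF cv gd sX gX, of "e / 2" N] that by simp
  show thesis
  proof (rule that)
    fix j assume j: "j \<in> J"
    obtain e where e: "e > 0" "\<And>z. z \<in> E \<Longrightarrow> e \<le> norm (g (p j) - g z)" "\<And>i. i \<in> J - {j} \<Longrightarrow> e \<le> norm (g (p j) - g (p i))"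
      using sep[OF j] by blast
    show "p j \<notin> closure E"
    proof
      assume "p j \<in> closure E"
      then obtain z where z: "\<And>k. z k \<in> E" "z \<longlonglongrightarrow> p j" unfolding closure_sequential by blast
      have "(\<lambda>k. norm (g (p j) - g (z k))) \<longlonglongrightarrow> norm (g (p j) - g (p j))"
        using g z(2) continuous_on_tendsto_compose[of UNIV g z "p j"] by (intro tendsto_intros) auto
      then have "e \<le> norm (g (p j) - g (p j))" by (rule LIMSEQ_le_const) (use e(2) z(1) in blast)
      then show False using e(1) by simp
    qed
    \<comment> \<open>With the first point fixed at \<open>p j\<close>, the norm of its projection
      serves as N, and one d works for all z; this covers (b) and (c).\<close>
    obtain d where d: "d > 0" "\<And>z. F (p j) - F z - g z \<bullet> (p j - z) < d \<Longrightarrow> norm (g (p j) - g z) \<le> e / 2"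
      using close[OF e(1), of "norm (orth_proj X (p j))"] by blast
    have far: "F z + g z \<bullet> (p j - z) \<le> F (p j) - d" if "e \<le> norm (g (p j) - g z)" for z
      using d(2)[of z] that e(1) by linarith
    show "\<exists>d>0. \<forall>i\<in>J - {j}. F (p i) + g (p i) \<bullet> (p j - p i) \<le> F (p j) - d"
      using far e(3) d(1) by blast
    show "\<exists>d>0. \<forall>z\<in>E. F z + g z \<bullet> (p j - z) \<le> F (p j) - d"
      using far e(2) d(1) by blast
    fix N
    obtain d where d: "d > 0" "\<And>x. norm (orth_proj X x) \<le> N \<Longrightarrow> F x - F (p j) - g (p j) \<bullet> (x - p j) < d
        \<Longrightarrow> norm (g x - g (p j)) \<le> e / 2"
      using close[OF e(1), of N] by blast
    have "F (p j) + g (p j) \<bullet> (x - p j) \<le> F x - d" if "x \<in> E" "norm (orth_proj X x) \<le> N" for x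
      using d(2)[OF that(2)] e(2)[OF that(1)] e(1) by (subst (asm) norm_minus_commute) linarith
    then show "\<exists>d>0. \<forall>x\<in>E. norm (orth_proj X x) \<le> N \<longrightarrow> F (p j) + g (p j) \<bullet> (x - p j) \<le> F x - d"
      using d(1) by blast
  next
    define U where "U = g ` E \<union> (\<lambda>j. g (p j)) ` J"
    have UX: "{u - v | u v. u \<in> U \<and> v \<in> U} \<subseteq> X" using gX by (auto simp: U_def)
    have "Y \<union> (\<lambda>j. g (p j) - g x0) ` J \<subseteq> span {u - v | u v. u \<in> U \<and> v \<in> U}"
    proof (rule Un_least)
      show "Y \<subseteq> span {u - v | u v. u \<in> U \<and> v \<in> U}" unfolding Y by (intro span_mono) (auto simp: U_def)
      have "(\<lambda>j. g (p j) - g x0) ` J \<subseteq> {u - v | u v. u \<in> U \<and> v \<in> U}" using x0 by (auto simp: U_def)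
      then show "(\<lambda>j. g (p j) - g x0) ` J \<subseteq> span {u - v | u v. u \<in> U \<and> v \<in> U}" using span_superset by blast
    qed
    then have "X \<subseteq> span {u - v | u v. u \<in> U \<and> v \<in> U}" by (subst p(2)) (intro span_minimal subspace_span)
    moreover have "span {u - v | u v. u \<in> U \<and> v \<in> U} \<subseteq> X" by (intro span_minimal UX sX)
    ultimately show "X = span {u - v | u v. u \<in> g ` E \<union> (\<lambda>j. g (p j)) ` J \<and> v \<in> g ` E \<union> (\<lambda>j. g (p j)) ` J}"
      unfolding U_def by (rule antisym)
  qed
qed

section \<open>Uniqueness of gradients and the assembly of both implications\<close>

lemma convex_GDERIV_unique:
  fixes F :: "'a::euclidean_space \<Rightarrow> real"
  assumes "convex_on UNIV F" "GDERIV F x :> g" "GDERIV F x :> h"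
  shows "g = h"
  using superdiff_subgradient_unique[OF superdiff_GDERIV[OF assms(3)]] convex_GDERIV_ge[OF assms(1,2)] by blast

text \<open>The body is the clause of the theorem on p, \<beta> and w as it reads after the strict
  SUP and INF inequalities have been rewritten as gaps, so that it can be folded
  syntactically.\<close>

definition new_tangent_planes where
  "new_tangent_planes E f G X J p \<beta> w \<longleftrightarrow>
        (\<forall>j\<in>J. p j \<notin> closure (E :: 'a::euclidean_space set)) \<and>
        X = span {u - v | u v. u \<in> G ` E \<union> w ` J \<and> v \<in> G ` E \<union> w ` J} \<and>
        (\<forall>j\<in>J. \<exists>d>0. \<forall>i\<in>J - {j}. \<beta> i + w i \<bullet> (p j - p i) \<le> \<beta> j - d) \<and>
        (\<forall>j\<in>J. \<forall>N :: nat. \<exists>d>0. \<forall>z\<in>{z \<in> E. norm (G z) \<le> real N}. f z + G z \<bullet> (p j - z) \<le> \<beta> j - d) \<and>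
        (\<forall>N :: nat. \<exists>d>0. \<forall>x\<in>{x \<in> E. norm (orth_proj X x) \<le> real N}.
          d \<le> f x - Max ((\<lambda>j. \<beta> j + w j \<bullet> (x - p j)) ` J))"

theorem theorem1p8:
  fixes E :: "(real^'n) set" and f :: "real^'n \<Rightarrow> real" and G :: "real^'n \<Rightarrow> real^'n"
  shows
    "(\<exists>F :: real^'n \<Rightarrow> real. convex_on UNIV F \<and> class_C1 F \<and>
        (\<forall>x\<in>E. F x = f x \<and> GDERIV F x :> G x))
     \<longleftrightarrow>
     (continuous_on E G \<and> (\<forall>x\<in>E. \<forall>y\<in>E. f x \<ge> f y + G y \<bullet> (x - y))) \<and>
     (\<forall>x :: nat \<Rightarrow> real^'n.
        range x \<subseteq> E \<longrightarrow> filterlim (\<lambda>k. norm (G (x k))) at_top sequentially \<longrightarrow>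
        filterlim (\<lambda>k. (G (x k) \<bullet> x k - f (x k)) / norm (G (x k))) at_top sequentially) \<and>
     (\<exists>X. subspace X \<and>
        (let Y = span {G x - G y | x y. x \<in> E \<and> y \<in> E}; k = dim Y; d = dim X in
           Y \<subseteq> X \<and>
           (Y = X \<or>
            (\<exists>(p :: nat \<Rightarrow> real^'n) (\<beta> :: nat \<Rightarrow> real) (w :: nat \<Rightarrow> real^'n).
               (\<forall>j\<in>{1..d - k}. p j \<notin> closure E) \<and>
               X = span {u - v | u v. u \<in> G ` E \<union> w ` {1..d - k} \<and> v \<in> G ` E \<union> w ` {1..d - k}} \<and>
               (\<forall>j\<in>{1..d - k}.
                  ereal (\<beta> j) > (SUP i\<in>{1..d - k} - {j}. ereal (\<beta> i + w i \<bullet> (p j - p i)))) \<and>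
               (\<forall>j\<in>{1..d - k}. \<forall>N :: nat.
                  ereal (\<beta> j) > (SUP z\<in>{z \<in> E. norm (G z) \<le> real N}. ereal (f z + G z \<bullet> (p j - z)))) \<and>
               (\<forall>N :: nat.
                  (INF x\<in>{x \<in> E. norm (orth_proj X x) \<le> real N}.
                     ereal (f x - Max ((\<lambda>j. \<beta> j + w j \<bullet> (x - p j)) ` {1..d - k}))) > 0)))) \<and>
        (\<forall>x z :: nat \<Rightarrow> real^'n.
           range x \<subseteq> E \<longrightarrow> range z \<subseteq> E \<longrightarrow>
           bounded (range (\<lambda>k. orth_proj X (x k))) \<longrightarrow> bounded (range (\<lambda>k. G (z k))) \<longrightarrow>
           (\<lambda>k. f (x k) - f (z k) - G (z k) \<bullet> (x k - z k)) \<longlonglongrightarrow> 0 \<longrightarrow>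
           (\<lambda>k. norm (G (x k) - G (z k))) \<longlonglongrightarrow> 0))"
  (is "?ext \<longleftrightarrow> ?cond_i \<and> ?cond_ii \<and> ?cond_X")
proof (cases "E = {}")
  \<comment> \<open>Without data there is no point to start a supremum from. The zero function
    extends, and Y = X = {0}.\<close>
  case True
  have "?ext"
    by (rule exI[of _ "\<lambda>_. 0"]) (auto simp: True convex_on_const class_C1_def intro!: exI[of _ "\<lambda>_. 0"] GDERIV_const)
  moreover have "?cond_X"
    by (rule exI[of _ "{0}"]) (simp add: True)
  ultimately show ?thesis by (auto simp: True)
next
  case False
  define Y where "Y = span {G x - G y | x y. x \<in> E \<and> y \<in> E}"
  show ?thesis
  proof
    assume ?ext
    then obtain F where cv: "convex_on UNIV F" and C1: "class_C1 F" and FE: "\<And>x. x \<in> E \<Longrightarrow> F x = f x"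
      and FG: "\<And>x. x \<in> E \<Longrightarrow> GDERIV F x :> G x" by blast
    obtain g where gd: "\<And>x. GDERIV F x :> g x" and g: "continuous_on UNIV g" using C1 unfolding class_C1_def by blast
    have gG: "g x = G x" if "x \<in> E" for x by (rule convex_GDERIV_unique[OF cv gd FG[OF that]])
    have ge: "F x + g x \<bullet> (y - x) \<le> F y" for x y by (rule convex_GDERIV_ge[OF cv gd])
    have "continuous_on E g" using g continuous_on_subset by blast
    then have contG: "continuous_on E G" using gG by (simp cong: continuous_on_cong)
    have i: ?cond_i using contG ge FE gG by (metis (no_types))
    have ii: ?cond_ii
    proof (intro allI impI)
      fix x :: "nat \<Rightarrow> real^'n" assume x: "range x \<subseteq> E" and lim: "filterlim (\<lambda>k. norm (G (x k))) at_top sequentially"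
      have xE: "x k \<in> E" for k using x by blast
      have "filterlim (\<lambda>k. (G (x k) \<bullet> x k - F (x k)) / norm (G (x k))) at_top sequentially"
        by (rule convex_conjugate_superlinear[where F = F and x = x and G = G, OF cv _ lim])
          (use ge gG[OF xE] in metis)
      then show "filterlim (\<lambda>k. (G (x k) \<bullet> x k - f (x k)) / norm (G (x k))) at_top sequentially"
        using FE[OF xE] by simp
    qed
    define X where "X = span {g x - g y | x y. True}"
    have sX: "subspace X" by (simp add: X_def)
    have gX: "g x - g y \<in> X" for x y unfolding X_def by (rule span_base) blast
    have Yg: "Y = span {g x - g y | x y. x \<in> E \<and> y \<in> E}"
      unfolding Y_def by (intro arg_cong[where f = span]) (rule Collect_cong, metis gG)
    have YX: "Y \<subseteq> X" unfolding X_def Yg by (intro span_mono) blast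
    define J where "J = {1..dim X - dim Y}"
    have iii: "Y \<subseteq> X \<and> (Y = X \<or> (\<exists>p \<beta> w. new_tangent_planes E f G X J p \<beta> w))"
    proof (cases "Y = X")
      case YneX: False
      obtain p :: "nat \<Rightarrow> real^'n" where p: "\<And>j. j \<in> J \<Longrightarrow> p j \<notin> closure E"
        "X = span {u - v | u v. u \<in> g ` E \<union> (\<lambda>j. g (p j)) ` J \<and> v \<in> g ` E \<union> (\<lambda>j. g (p j)) ` J}"
        "\<And>j. j \<in> J \<Longrightarrow> \<exists>d>0. \<forall>i\<in>J - {j}. F (p i) + g (p i) \<bullet> (p j - p i) \<le> F (p j) - d"
        "\<And>j. j \<in> J \<Longrightarrow> \<exists>d>0. \<forall>z\<in>E. F z + g z \<bullet> (p j - z) \<le> F (p j) - d"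
        "\<And>N j. j \<in> J \<Longrightarrow> \<exists>d>0. \<forall>x\<in>E. norm (orth_proj X x) \<le> N \<longrightarrow> F (p j) + g (p j) \<bullet> (x - p j) \<le> F x - d"
        by (rule C1_convex_separating_points[OF cv gd g False X_def Yg J_def]) blast
      have gE: "g ` E = G ` E" using gG by force
      have Jne: "finite J" "J \<noteq> {}"
      proof -
        show "finite J" by (simp add: J_def)
        \<comment> \<open>A proper inclusion of subspaces makes J nonempty, so that the Max in (d)
          is a genuine maximum.\<close>
        have "dim Y < dim X"
        proof (rule ccontr)
          assume "\<not> dim Y < dim X"
          then have "Y = X" using subspace_dim_equal[OF _ sX YX] by (simp add: Y_def)
          then show False using YneX by simp
        qed
        then show "J \<noteq> {}" by (simp add: J_def)
      qed
      have "\<exists>d>0. \<forall>x\<in>{x \<in> E. norm (orth_proj X x) \<le> real N}.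
          d \<le> f x - Max ((\<lambda>j. F (p j) + g (p j) \<bullet> (x - p j)) ` J)" for N :: nat
      proof -
        have "\<exists>d>0. \<forall>j\<in>J. \<forall>x\<in>E. norm (orth_proj X x) \<le> real N \<longrightarrow> F (p j) + g (p j) \<bullet> (x - p j) \<le> F x - d"
          by (rule finite_uniform_gap[OF Jne(1) p(5)]) force+
        then obtain d where d: "d > 0" "\<And>j x. j \<in> J \<Longrightarrow> x \<in> E \<Longrightarrow> norm (orth_proj X x) \<le> real N \<Longrightarrow>
            F (p j) + g (p j) \<bullet> (x - p j) \<le> F x - d" by blast
        have "d \<le> f x - Max ((\<lambda>j. F (p j) + g (p j) \<bullet> (x - p j)) ` J)"
          if "x \<in> E" "norm (orth_proj X x) \<le> real N" for x
        proof -
          have "Max ((\<lambda>j. F (p j) + g (p j) \<bullet> (x - p j)) ` J) \<le> F x - d"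
            using Jne d(2)[OF _ that] by simp
          then show ?thesis using FE[OF that(1)] by simp
        qed
        then show ?thesis using d(1) by blast
      qed
      moreover have "\<exists>d>0. \<forall>z\<in>{z \<in> E. norm (G z) \<le> real N}. f z + G z \<bullet> (p j - z) \<le> F (p j) - d"
        if "j \<in> J" for j and N :: nat
        using p(4)[OF that] FE gG by fastforce
      ultimately have "new_tangent_planes E f G X J p (\<lambda>j. F (p j)) (\<lambda>j. g (p j))"
        unfolding new_tangent_planes_def using p(1,3) p(2)[unfolded gE] by blast
      then show ?thesis using YX by blast
    qed (use YX in blast)
    have iv: "\<forall>x z :: nat \<Rightarrow> real^'n.
        range x \<subseteq> E \<longrightarrow> range z \<subseteq> E \<longrightarrow>
        bounded (range (\<lambda>k. orth_proj X (x k))) \<longrightarrow> bounded (range (\<lambda>k. G (z k))) \<longrightarrow>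
        (\<lambda>k. f (x k) - f (z k) - G (z k) \<bullet> (x k - z k)) \<longlonglongrightarrow> 0 \<longrightarrow>
        (\<lambda>k. norm (G (x k) - G (z k))) \<longlonglongrightarrow> 0"
    proof (intro allI impI)
      fix x z :: "nat \<Rightarrow> real^'n" assume "range x \<subseteq> E" "range z \<subseteq> E"
      then have xz: "x k \<in> E" "z k \<in> E" for k by auto
      assume "bounded (range (\<lambda>k. orth_proj X (x k)))"
      then obtain N where N: "\<And>k. norm (orth_proj X (x k)) \<le> N" unfolding bounded_iff by auto
      assume lim: "(\<lambda>k. f (x k) - f (z k) - G (z k) \<bullet> (x k - z k)) \<longlonglongrightarrow> 0"
      show "(\<lambda>k. norm (G (x k) - G (z k))) \<longlonglongrightarrow> 0"
      proof (rule LIMSEQ_I)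
        fix e :: real assume "e > 0"
        then have "e / 2 > 0" by simp
        then obtain d where d: "d > 0" "\<And>x z. norm (orth_proj X x) \<le> N \<Longrightarrow> F x - F z - g z \<bullet> (x - z) < d \<Longrightarrow> norm (g x - g z) \<le> e / 2"
          using gradients_close_if_nearly_tangent[OF cv gd sX gX, of "e / 2" N] by blast
        obtain K where K: "\<And>k. k \<ge> K \<Longrightarrow> norm (f (x k) - f (z k) - G (z k) \<bullet> (x k - z k) - 0) < d"
          using LIMSEQ_D[OF lim d(1)] by blast
        have "norm (norm (G (x k) - G (z k)) - 0) < e" if "k \<ge> K" for k
          using d(2)[OF N, of k "z k"] K[OF that] \<open>e > 0\<close> by (simp add: FE gG xz abs_less_iff)
        then show "\<exists>K. \<forall>k\<ge>K. norm (norm (G (x k) - G (z k)) - 0) < e" by blast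
      qed
    qed
    have ?cond_X
      unfolding Let_def SUP_ereal_less_iff INF_ereal_greater_iff Y_def[symmetric] new_tangent_planes_def[symmetric]
      using sX iii[unfolded J_def] iv by blast
    with i ii show "?cond_i \<and> ?cond_ii \<and> ?cond_X" by blast
  next
    assume rhs: "?cond_i \<and> ?cond_ii \<and> ?cond_X"
    then have ineq: "f y + G y \<bullet> (x - y) \<le> f x" if "x \<in> E" "y \<in> E" for x y using that by blast
    have fin: "\<exists>c. \<forall>z\<in>E. f z + G z \<bullet> (y - z) \<le> c" for y
      by (rule tangent_planes_bounded[OF False ineq]) (use rhs in blast)+
    obtain X where sX: "subspace X"
      and iii: "Y \<subseteq> X \<and> (Y = X \<or> (\<exists>p \<beta> w. new_tangent_planes E f G X {1..dim X - dim Y} p \<beta> w))"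
      and iv: "\<forall>x z :: nat \<Rightarrow> real^'n.
        range x \<subseteq> E \<longrightarrow> range z \<subseteq> E \<longrightarrow>
        bounded (range (\<lambda>k. orth_proj X (x k))) \<longrightarrow> bounded (range (\<lambda>k. G (z k))) \<longrightarrow>
        (\<lambda>k. f (x k) - f (z k) - G (z k) \<bullet> (x k - z k)) \<longlonglongrightarrow> 0 \<longrightarrow>
        (\<lambda>k. norm (G (x k) - G (z k))) \<longlonglongrightarrow> 0"
      using conjunct2[OF conjunct2[OF rhs]]
      unfolding Let_def SUP_ereal_less_iff INF_ereal_greater_iff Y_def[symmetric] new_tangent_planes_def[symmetric] by blast
    have close: "\<exists>d>0. \<forall>x\<in>E. \<forall>z\<in>E. norm (orth_proj X x) \<le> N \<longrightarrow> norm (G z) \<le> N \<longrightarrow>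
        f x - f z - G z \<bullet> (x - z) < d \<longrightarrow> norm (G x - G z) \<le> e" if "e > 0" for N e
      by (rule gradients_close_of_sequences[OF ineq iv[rule_format] that])
    obtain F where F: "convex_on UNIV F" "\<And>x. \<exists>g. superdiff F x g" "\<And>x. x \<in> E \<Longrightarrow> F x = f x"
      "\<And>x y. x \<in> E \<Longrightarrow> f x + G x \<bullet> (y - x) \<le> F y"
    proof (cases "Y = X")
      case True
      show thesis
        by (rule convex_C1_extension[OF False True[symmetric, unfolded Y_def] ineq fin close]) (assumption | rule that; blast)+
    next
      case YneX: False
      define J where "J = {1..dim X - dim Y}"
      obtain p :: "nat \<Rightarrow> real^'n" and \<beta> :: "nat \<Rightarrow> real" and w :: "nat \<Rightarrow> real^'n" where
        pw: "new_tangent_planes E f G X J p \<beta> w"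
        using iii YneX unfolding J_def by blast
      note pw = pw[unfolded new_tangent_planes_def]
      note pw_E = pw[THEN conjunct1, rule_format]
        and X = pw[THEN conjunct2, THEN conjunct1]
        and b = pw[THEN conjunct2, THEN conjunct2, THEN conjunct1, rule_format]
        and pw_c = pw[THEN conjunct2, THEN conjunct2, THEN conjunct2, THEN conjunct1, rule_format]
        and pw_d = pw[THEN conjunct2, THEN conjunct2, THEN conjunct2, THEN conjunct2, rule_format]
      have J: "finite J" by (simp add: J_def)
      have c: "\<exists>d>0. \<forall>z\<in>E. norm (G z) \<le> N \<longrightarrow> f z + G z \<bullet> (p j - z) \<le> \<beta> j - d" if j: "j \<in> J" for j N
      proof -
        \<comment> \<open>The theorem bounds slopes and projections by naturals, the extension lemma
          by reals; rounding up passes from one to the other.\<close>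
        obtain n :: nat where n: "N \<le> real n" using real_arch_simple by blast
        obtain d where "d > 0" "\<forall>z\<in>{z \<in> E. norm (G z) \<le> real n}. f z + G z \<bullet> (p j - z) \<le> \<beta> j - d"
          using pw_c[OF j, of n] by blast
        then show ?thesis using n by (intro exI[of _ d]) auto
      qed
      have d: "\<exists>d>0. \<forall>x\<in>E. norm (orth_proj X x) \<le> N \<longrightarrow> (\<forall>j\<in>J. \<beta> j + w j \<bullet> (x - p j) \<le> f x - d)" for N
      proof -
        obtain n :: nat where n: "N \<le> real n" using real_arch_simple by blast
        obtain d where d: "d > 0" "\<And>x. x \<in> E \<Longrightarrow> norm (orth_proj X x) \<le> real n \<Longrightarrow>
            d \<le> f x - Max ((\<lambda>j. \<beta> j + w j \<bullet> (x - p j)) ` J)"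
          using pw_d[of n] by blast
        have "\<beta> j + w j \<bullet> (x - p j) \<le> f x - d" if "x \<in> E" "norm (orth_proj X x) \<le> N" "j \<in> J" for x j
        proof -
          have "\<beta> j + w j \<bullet> (x - p j) \<le> Max ((\<lambda>j. \<beta> j + w j \<bullet> (x - p j)) ` J)"
            using J that(3) by (intro Max_ge) auto
          then show ?thesis using d(2)[OF that(1)] that(2) n by simp
        qed
        then show ?thesis using d(1) by blast
      qed
      have pE: "p j \<notin> E" if "j \<in> J" for j using pw_E[OF that] closure_subset by blast
      show thesis
        by (rule convex_C1_extension_adding_points[OF False J pE X ineq fin close b c d]) (assumption | rule that; blast)+
    qed
    have "class_C1 F" by (rule convex_superdiff_class_C1[OF F(1,2)])
    moreover have "GDERIV F x :> G x" if "x \<in> E" for x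
    proof -
      obtain g where g: "superdiff F x g" using F(2) by blast
      \<comment> \<open>The prescribed plane lies below F and touches it at x, so \<open>G x\<close>
        is a subgradient, and the upper expansion leaves no other slope.\<close>
      then have "G x = g" by (rule superdiff_subgradient_unique) (use F(3,4) that in simp)
      then show ?thesis using convex_superdiff_GDERIV[OF F(1) g] by simp
    qed
    ultimately show ?ext using F(1,3) by blast
  qed
qed

end
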